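(* Let $A\in\mathbb{C}^{2\times2}$ be non-singular. For all $z\notin\mathrm{Spec}(AD)$, the resolvent $(AD-z)^{-1}$ is compact.
   Context: Let $W^{2,2}$ be the Sobolev space of all $f\in L^2(0,1)\otimes\mathbb{C}^2$ whose generalized derivative $f''$ lies in $L^2(0,1)\otimes\mathbb{C}^2$, and write $f=\begin{pmatrix}\phi\\ \gamma\end{pmatrix}$. The operator $D$ acts on $L^2(0,1)\otimes\mathbb{C}^2$ by $Df=-f''$ with domain $\mathrm{Dom}(D)=\{f\in W^{2,2}:\phi(0)=\phi(1)=0,\ \gamma'(0)=\gamma'(1)=0\}$. $AD$ is the operator $f\mapsto -Af''$ with domain $\mathrm{Dom}(D)$. $\mathrm{Spec}$ denotes the spectrum. *)

theory Defs
  imports "HOL-Analysis.Analysis"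
begin

section \<open>The Hilbert space of square-integrable functions on (0,1) with values in C^2\<close>

abbreviation I01 :: "real measure" where
  "I01 \<equiv> lebesgue_on {0<..<1}"

definition square_integrable :: "(real \<Rightarrow> complex^2) \<Rightarrow> bool" where
  "square_integrable f \<longleftrightarrow>
     f \<in> borel_measurable I01 \<and> integrable I01 (\<lambda>x. (norm (f x))\<^sup>2)"

definition L2_rel :: "(real \<Rightarrow> complex^2) \<Rightarrow> (real \<Rightarrow> complex^2) \<Rightarrow> bool" where
  "L2_rel f g \<longleftrightarrow> square_integrable f \<and> square_integrable g \<and> (AE x in I01. f x = g x)"

lemma square_integrable_zero: "square_integrable (\<lambda>x. 0)"
  by (simp add: square_integrable_def)

lemma square_integrable_add:
  assumes "square_integrable f" "square_integrable g"
  shows "square_integrable (\<lambda>x. f x + g x)"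
proof -
  have m: "f \<in> borel_measurable I01" "g \<in> borel_measurable I01"
    using assms by (auto simp: square_integrable_def)
  have "integrable I01 (\<lambda>x. 2 * (norm (f x))\<^sup>2 + 2 * (norm (g x))\<^sup>2)"
    using assms by (auto simp: square_integrable_def)
  then have "integrable I01 (\<lambda>x. (norm (f x + g x))\<^sup>2)"
  proof (rule Bochner_Integration.integrable_bound)
    show "(\<lambda>x. (norm (f x + g x))\<^sup>2) \<in> borel_measurable I01"
      using m by measurable
    have "(norm (f x + g x))\<^sup>2 \<le> 2 * (norm (f x))\<^sup>2 + 2 * (norm (g x))\<^sup>2" for x
    proof -
      have "(norm (f x + g x))\<^sup>2 \<le> (norm (f x) + norm (g x))\<^sup>2"
        by (intro power_mono norm_triangle_ineq norm_ge_zero)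
      also have "\<dots> \<le> 2 * (norm (f x))\<^sup>2 + 2 * (norm (g x))\<^sup>2"
        using sum_squares_bound[of "norm (f x)" "norm (g x)"] by (simp add: power2_sum)
      finally show ?thesis .
    qed
    then show "AE x in I01. norm ((norm (f x + g x))\<^sup>2)
        \<le> norm (2 * (norm (f x))\<^sup>2 + 2 * (norm (g x))\<^sup>2)"
      by simp
  qed
  then show ?thesis
    using m by (simp add: square_integrable_def)
qed

lemma square_integrable_bounded_linear:
  fixes T :: "complex^2 \<Rightarrow> complex^2"
  assumes "bounded_linear T" "square_integrable f"
  shows "square_integrable (\<lambda>x. T (f x))"
proof -
  obtain K where K: "\<And>v. norm (T v) \<le> norm v * K"
    using bounded_linear.bounded[OF assms(1)] by blast
  have m: "f \<in> borel_measurable I01"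
    using assms by (auto simp: square_integrable_def)
  have Tm: "(\<lambda>x. T (f x)) \<in> borel_measurable I01"
    by (rule measurable_compose[OF m borel_measurable_continuous_onI])
       (rule linear_continuous_on[OF assms(1)])
  have "integrable I01 (\<lambda>x. K\<^sup>2 * (norm (f x))\<^sup>2)"
    using assms by (auto simp: square_integrable_def)
  then have "integrable I01 (\<lambda>x. (norm (T (f x)))\<^sup>2)"
  proof (rule Bochner_Integration.integrable_bound)
    show "(\<lambda>x. (norm (T (f x)))\<^sup>2) \<in> borel_measurable I01"
      using Tm by measurable
    have "(norm (T (f x)))\<^sup>2 \<le> K\<^sup>2 * (norm (f x))\<^sup>2" for x
      using power_mono[OF K[of "f x"], of 2] by (simp add: power_mult_distrib mult.commute)
    then show "AE x in I01. norm ((norm (T (f x)))\<^sup>2) \<le> norm (K\<^sup>2 * (norm (f x))\<^sup>2)"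
      by simp
  qed
  then show ?thesis
    using Tm by (simp add: square_integrable_def)
qed

lemma square_integrable_scaleR:
  "square_integrable f \<Longrightarrow> square_integrable (\<lambda>x. c *\<^sub>R f x)"
  by (rule square_integrable_bounded_linear[OF bounded_linear_scaleR_right])

lemma square_integrable_uminus: "square_integrable f \<Longrightarrow> square_integrable (\<lambda>x. - f x)"
  using square_integrable_scaleR[of f "-1"] by simp

lemma square_integrable_diff:
  "square_integrable f \<Longrightarrow> square_integrable g \<Longrightarrow> square_integrable (\<lambda>x. f x - g x)"
  using square_integrable_add[of f "\<lambda>x. - g x"] square_integrable_uminus[of g] by simp

lemma bounded_linear_matrix_vector_complex:
  fixes A :: "complex^2^2"
  shows "bounded_linear ((*v) A)"
proof -
  have "linear ((*v) A)"
    by (intro linearI)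
       (simp_all add: vec_eq_iff matrix_vector_mult_def scaleR_sum_right
          distrib_left sum.distrib)
  then show ?thesis
    by (simp add: linear_conv_bounded_linear)
qed

lemma bounded_linear_vector_scalar_mult_complex:
  "bounded_linear (\<lambda>v::complex^2. c *s v)"
proof -
  have "linear (\<lambda>v::complex^2. c *s v)"
    by (intro linearI) (simp_all add: vec_eq_iff algebra_simps)
  then show ?thesis
    by (simp add: linear_conv_bounded_linear)
qed

lemma square_integrable_inner:
  assumes "square_integrable f" "square_integrable g"
  shows "integrable I01 (\<lambda>x. f x \<bullet> g x)"
proof -
  have m: "f \<in> borel_measurable I01" "g \<in> borel_measurable I01"
    using assms by (auto simp: square_integrable_def)
  have "integrable I01 (\<lambda>x. (norm (f x))\<^sup>2 + (norm (g x))\<^sup>2)"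
    using assms by (auto simp: square_integrable_def)
  then show ?thesis
  proof (rule Bochner_Integration.integrable_bound)
    show "(\<lambda>x. f x \<bullet> g x) \<in> borel_measurable I01"
      using m by measurable
    have "\<bar>f x \<bullet> g x\<bar> \<le> (norm (f x))\<^sup>2 + (norm (g x))\<^sup>2" for x
    proof -
      have "\<bar>f x \<bullet> g x\<bar> \<le> norm (f x) * norm (g x)"
        by (rule Cauchy_Schwarz_ineq2)
      also have "\<dots> \<le> 2 * norm (f x) * norm (g x)"
        by simp
      also have "\<dots> \<le> (norm (f x))\<^sup>2 + (norm (g x))\<^sup>2"
        by (rule sum_squares_bound)
      finally show ?thesis .
    qed
    then show "AE x in I01. norm (f x \<bullet> g x) \<le> norm ((norm (f x))\<^sup>2 + (norm (g x))\<^sup>2)"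
      by simp
  qed
qed

quotient_type L2 = "real \<Rightarrow> complex^2" / partial: L2_rel
proof (rule part_equivpI)
  show "\<exists>f. L2_rel f f"
    using square_integrable_zero by (auto simp: L2_rel_def)
  show "symp L2_rel"
    by (rule sympI) (auto simp: L2_rel_def)
  show "transp L2_rel"
    by (rule transpI) (auto simp: L2_rel_def)
qed

text \<open>The inner product below is the real part of the Hilbert space inner product; it induces
  the usual norm.\<close>

instantiation L2 :: real_inner
begin

lift_definition zero_L2 :: L2 is "\<lambda>x. 0"
  by (simp add: L2_rel_def square_integrable_zero)

lift_definition plus_L2 :: "L2 \<Rightarrow> L2 \<Rightarrow> L2" is "\<lambda>f g x. f x + g x"
  by (auto simp: L2_rel_def square_integrable_add)

lift_definition uminus_L2 :: "L2 \<Rightarrow> L2" is "\<lambda>f x. - f x"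
  by (auto simp: L2_rel_def square_integrable_uminus)

lift_definition minus_L2 :: "L2 \<Rightarrow> L2 \<Rightarrow> L2" is "\<lambda>f g x. f x - g x"
  by (auto simp: L2_rel_def square_integrable_diff)

lift_definition scaleR_L2 :: "real \<Rightarrow> L2 \<Rightarrow> L2" is "\<lambda>c f x. c *\<^sub>R f x"
  by (auto simp: L2_rel_def square_integrable_scaleR)

lift_definition inner_L2 :: "L2 \<Rightarrow> L2 \<Rightarrow> real" is "\<lambda>f g. LINT x|I01. f x \<bullet> g x"
proof -
  fix f f' g g' :: "real \<Rightarrow> complex^2"
  assume "L2_rel f f'" "L2_rel g g'"
  then show "(LINT x|I01. f x \<bullet> g x) = (LINT x|I01. f' x \<bullet> g' x)"
    by (intro integral_cong_AE borel_measurable_integrable square_integrable_inner)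
       (auto simp: L2_rel_def)
qed

definition norm_L2 :: "L2 \<Rightarrow> real" where "norm_L2 f = sqrt (f \<bullet> f)"

definition sgn_L2 :: "L2 \<Rightarrow> L2" where "sgn_L2 f = inverse (norm f) *\<^sub>R f"

definition dist_L2 :: "L2 \<Rightarrow> L2 \<Rightarrow> real" where "dist_L2 f g = norm (f - g)"

definition uniformity_L2 :: "(L2 \<times> L2) filter" where
  "uniformity_L2 = (INF e\<in>{0<..}. principal {(f, g). dist f g < e})"

definition open_L2 :: "L2 set \<Rightarrow> bool" where
  "open_L2 U \<longleftrightarrow> (\<forall>f\<in>U. eventually (\<lambda>(f', g). f' = f \<longrightarrow> g \<in> U) uniformity)"

instance
proof
  fix f g h :: L2 and r s :: real
  show "f + g + h = f + (g + h)"
    by transfer (auto simp: L2_rel_def square_integrable_add algebra_simps)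
  show "f + g = g + f"
    by transfer (auto simp: L2_rel_def square_integrable_add algebra_simps)
  show "0 + f = f"
    by transfer (auto simp: L2_rel_def)
  show "- f + f = 0"
    by transfer (auto simp: L2_rel_def square_integrable_zero)
  show "f - g = f + - g"
    by transfer (auto simp: L2_rel_def square_integrable_diff)
  show "r *\<^sub>R (f + g) = r *\<^sub>R f + r *\<^sub>R g"
    by transfer (auto simp: L2_rel_def square_integrable_scaleR square_integrable_add
        scaleR_add_right)
  show "(r + s) *\<^sub>R f = r *\<^sub>R f + s *\<^sub>R f"
    by transfer (auto simp: L2_rel_def square_integrable_scaleR square_integrable_add
        scaleR_add_left)
  show "r *\<^sub>R s *\<^sub>R f = (r * s) *\<^sub>R f"
    by transfer (auto simp: L2_rel_def square_integrable_scaleR)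
  show "1 *\<^sub>R f = f"
    by transfer (auto simp: L2_rel_def)
  show "f \<bullet> g = g \<bullet> f"
    by transfer (simp add: inner_commute)
  show "(f + g) \<bullet> h = f \<bullet> h + g \<bullet> h"
    by transfer (simp add: L2_rel_def inner_add_left square_integrable_inner)
  show "(r *\<^sub>R f) \<bullet> g = r * (f \<bullet> g)"
    by transfer simp
  show "0 \<le> f \<bullet> f"
    by transfer simp
  show "(f \<bullet> f = 0) = (f = 0)"
  proof transfer
    fix f assume "L2_rel f f"
    then have f: "square_integrable f"
      by (simp add: L2_rel_def)
    then have "(LINT x|I01. f x \<bullet> f x) = 0 \<longleftrightarrow> (AE x in I01. f x \<bullet> f x = 0)"
      by (intro integral_nonneg_eq_0_iff_AE square_integrable_inner) simp_all
    then show "(LINT x|I01. f x \<bullet> f x) = 0 \<longleftrightarrow> L2_rel f (\<lambda>x. 0)"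
      using f by (simp add: L2_rel_def square_integrable_zero)
  qed
qed (simp_all add: norm_L2_def sgn_L2_def dist_L2_def uniformity_L2_def open_L2_def)

end

lift_definition scaleC_L2 :: "complex \<Rightarrow> L2 \<Rightarrow> L2" (infixr "*\<^sub>C" 75) is "\<lambda>c f x. c *s f x"
  by (auto simp: L2_rel_def
      intro: square_integrable_bounded_linear[OF bounded_linear_vector_scalar_mult_complex])

lift_definition matrix_L2 :: "complex^2^2 \<Rightarrow> L2 \<Rightarrow> L2" is "\<lambda>A f x. A *v f x"
  by (auto simp: L2_rel_def
      intro: square_integrable_bounded_linear[OF bounded_linear_matrix_vector_complex])


section \<open>Generalized second derivatives and the Sobolev space\<close>

definition test_function :: "(real \<Rightarrow> real) \<Rightarrow> bool" where
  "test_function \<eta> \<longleftrightarrow>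
     (\<forall>n x. (deriv ^^ n) \<eta> field_differentiable (at x)) \<and>
     (\<exists>K. compact K \<and> K \<subseteq> {0<..<1} \<and> (\<forall>x. x \<notin> K \<longrightarrow> \<eta> x = 0))"

text \<open>\<^const>\<open>rep_L2\<close> picks some square-integrable representative; the integrals do
  not depend on the choice. Real-valued test functions suffice, by linearity.\<close>

definition weak_second_deriv :: "L2 \<Rightarrow> L2 \<Rightarrow> bool" where
  "weak_second_deriv f g \<longleftrightarrow>
     (\<forall>\<eta>. test_function \<eta> \<longrightarrow>
        (LINT x|I01. (deriv ^^ 2) \<eta> x *\<^sub>R rep_L2 f x) = (LINT x|I01. \<eta> x *\<^sub>R rep_L2 g x))"

definition W22 :: "L2 set" where
  "W22 = {f. \<exists>g. weak_second_deriv f g}"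

definition second_deriv :: "L2 \<Rightarrow> L2" where
  "second_deriv f = (THE g. weak_second_deriv f g)"

text \<open>Every element of \<^const>\<open>W22\<close> has a unique continuously differentiable representative on
  the closed unit interval; the boundary values of the function and of its first derivative are
  those of this representative.\<close>

definition C1_representative :: "L2 \<Rightarrow> (real \<Rightarrow> complex^2) \<Rightarrow> (real \<Rightarrow> complex^2) \<Rightarrow> bool" where
  "C1_representative f u u' \<longleftrightarrow>
     (AE x in I01. rep_L2 f x = u x) \<and>
     (\<forall>x\<in>{0..1}. (u has_vector_derivative u' x) (at x within {0..1})) \<and>
     continuous_on {0..1} u'"


section \<open>The operators\<close>

definition Dom_D :: "L2 set" where
  "Dom_D = {f \<in> W22. \<exists>u u'. C1_representative f u u' \<and>
      u 0 $ 1 = 0 \<and> u 1 $ 1 = 0 \<and> u' 0 $ 2 = 0 \<and> u' 1 $ 2 = 0}"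

definition op_D :: "L2 \<Rightarrow> L2" where
  "op_D f = - second_deriv f"

definition op_AD :: "complex^2^2 \<Rightarrow> L2 \<Rightarrow> L2" where
  "op_AD A f = matrix_L2 A (op_D f)"


section \<open>Spectrum, resolvent and compact operators\<close>

text \<open>An unbounded operator is given by its domain \<open>S\<close> and a function \<open>T\<close>, whose values outside
  \<open>S\<close> are irrelevant.\<close>

definition resolvent :: "L2 set \<Rightarrow> (L2 \<Rightarrow> L2) \<Rightarrow> complex \<Rightarrow> L2 \<Rightarrow> L2" where
  "resolvent S T z = inv_into S (\<lambda>f. T f - z *\<^sub>C f)"

definition spectrum :: "L2 set \<Rightarrow> (L2 \<Rightarrow> L2) \<Rightarrow> complex set" where
  "spectrum S T = {z. \<not> (bij_betw (\<lambda>f. T f - z *\<^sub>C f) S UNIV \<and>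
      (\<exists>K. \<forall>g. norm (resolvent S T z g) \<le> K * norm g))}"

definition complex_linear :: "(L2 \<Rightarrow> L2) \<Rightarrow> bool" where
  "complex_linear T \<longleftrightarrow> (\<forall>f g. T (f + g) = T f + T g) \<and> (\<forall>c f. T (c *\<^sub>C f) = c *\<^sub>C T f)"

definition compact_operator :: "(L2 \<Rightarrow> L2) \<Rightarrow> bool" where
  "compact_operator T \<longleftrightarrow>
     complex_linear T \<and> (\<forall>B. bounded B \<longrightarrow> compact (closure (T ` B)))"

end

theory Submission
  imports Defs "HOL-Complex_Analysis.Great_Picard" "HOL-Computational_Algebra.Polynomial"
    "HOL-Real_Asymp.Real_Asymp"
begin

text \<open>Let \<open>f = (AD - z)\<^sup>-\<^sup>1 g\<close>. Since \<open>A\<close> is invertible, \<open>f'' = - A\<^sup>-\<^sup>1 (g + z f)\<close>, so the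
  \<open>L\<^sup>2\<close> norms of \<open>f\<close> and \<open>f''\<close> are both bounded by a multiple of the norm of \<open>g\<close>. Testing the weak
  equation with smoothed indicator functions shows that \<open>f'\<close> oscillates by at most the norm of
  \<open>f''\<close>, and the boundary conditions (the difference quotient of \<open>\<phi>\<close> over the whole interval
  vanishes, and so does \<open>\<gamma>'(0)\<close>) turn this into a uniform bound on \<open>f'\<close>. The resolvent therefore
  maps bounded sets to uniformly bounded, equi-Lipschitz sets of functions, and the
  Arzela-Ascoli theorem applies. That the resolvent is linear rests on the uniqueness of the weak
  second derivative.\<close>

section \<open>Smooth step functions\<close>

text \<open>The regularity half of \<open>test_function\<close>, split off from the support
  condition so that it also covers steps that stay equal to 1 on the right.\<close>

definition smooth :: "(real \<Rightarrow> real) \<Rightarrow> bool" where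
  "smooth f \<longleftrightarrow> (\<forall>n x. (deriv ^^ n) f field_differentiable (at x))"

text \<open>If differentiation never leaves \<open>S\<close>, then by induction neither do the
  iterated derivatives. Smoothness proofs thus need only one first derivative per shape of function,
  and no Leibniz formula.\<close>

lemma smooth_closed_set:
  assumes "\<And>f. f \<in> S \<Longrightarrow> \<exists>g\<in>S. \<forall>x. (f has_real_derivative g x) (at x)" "f \<in> S"
  shows "smooth f"
proof -
  have step: "deriv f \<in> S \<and> (\<forall>x. f field_differentiable (at x))" if f: "f \<in> S" for f
  proof -
    obtain g where g: "g \<in> S" "\<And>x. (f has_real_derivative g x) (at x)"
      using assms(1)[OF f] by blast
    then have "deriv f = g"
      by (auto intro: DERIV_imp_deriv)
    then show ?thesis
      using g by (auto simp: field_differentiable_def)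
  qed
  have "(deriv ^^ n) f \<in> S" for n
    by (induction n) (use assms(2) step in auto)
  then show ?thesis
    using step by (auto simp: smooth_def)
qed

lemma smooth_antiderivative:
  assumes "\<And>x. (f has_real_derivative g x) (at x)" "smooth g"
  shows "smooth f"
proof -
  have "deriv f = g"
    using assms(1) by (auto intro: DERIV_imp_deriv)
  then have "(deriv ^^ Suc n) f = (deriv ^^ n) g" for n
    by (simp add: funpow_swap1)
  moreover have "f field_differentiable (at x)" for x
    using assms(1) by (auto simp: field_differentiable_def)
  ultimately show ?thesis
    using assms(2) unfolding smooth_def by (metis funpow_0 not0_implies_Suc)
qed

lemma smooth_deriv: "smooth f \<Longrightarrow> smooth (deriv f)"
  unfolding smooth_def by (metis funpow_Suc_right comp_apply)

lemma smooth_has_deriv: "smooth f \<Longrightarrow> (f has_real_derivative deriv f x) (at x)"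
  unfolding smooth_def by (metis funpow_0 DERIV_deriv_iff_field_differentiable)

lemma smooth_continuous: "smooth f \<Longrightarrow> continuous_on S f"
  by (meson DERIV_continuous_on has_field_derivative_at_within smooth_has_deriv)

lemma smooth_cmult:
  assumes "smooth f"
  shows "smooth (\<lambda>x. c * f x)"
proof (rule smooth_closed_set[where S = "{h. \<exists>f. smooth f \<and> h = (\<lambda>x. c * f x)}"])
  fix h assume "h \<in> {h. \<exists>f. smooth f \<and> h = (\<lambda>x. c * f x)}"
  then obtain f where "smooth f" "h = (\<lambda>x. c * f x)" by blast
  then show "\<exists>g\<in>{h. \<exists>f. smooth f \<and> h = (\<lambda>x. c * f x)}. \<forall>x. (h has_real_derivative g x) (at x)"
    by (intro bexI[of _ "\<lambda>x. c * deriv f x"])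
       (auto intro: smooth_deriv DERIV_cmult[OF smooth_has_deriv])
qed (use assms in auto)

lemma smooth_diff:
  assumes "smooth f" "smooth g"
  shows "smooth (\<lambda>x. f x - g x)"
proof (rule smooth_closed_set[where S = "{h. \<exists>f g. smooth f \<and> smooth g \<and> h = (\<lambda>x. f x - g x)}"])
  fix h assume "h \<in> {h. \<exists>f g. smooth f \<and> smooth g \<and> h = (\<lambda>x. f x - g x)}"
  then obtain f g where "smooth f" "smooth g" "h = (\<lambda>x. f x - g x)" by blast
  then show "\<exists>k\<in>{h. \<exists>f g. smooth f \<and> smooth g \<and> h = (\<lambda>x. f x - g x)}.
      \<forall>x. (h has_real_derivative k x) (at x)"
    by (intro bexI[of _ "\<lambda>x. deriv f x - deriv g x"])
       (auto intro: smooth_deriv DERIV_diff smooth_has_deriv)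
qed (use assms in auto)

text \<open>The derivatives of \<open>exp (- 1 / x)\<close>, extended by zero, stay within this family.\<close>

definition flat :: "real poly \<Rightarrow> real \<Rightarrow> real" where
  "flat p x = (if x > 0 then poly p (1 / x) * exp (- (1 / x)) else 0)"

text \<open>With \<open>y = 1 / x\<close> this is the decay that makes the \<open>flat\<close>
  functions differentiable at the origin.\<close>

lemma poly_times_exp_minus_tendsto_0:
  "((\<lambda>y. poly p y * exp (- y)) \<longlongrightarrow> 0) (at_top :: real filter)"
proof -
  have "((\<lambda>y. \<Sum>i\<le>degree p. coeff p i * (y ^ i / exp y)) \<longlongrightarrow> 0) at_top"
    by (intro tendsto_null_sum tendsto_mult_right_zero tendsto_power_div_exp_0)
  moreover have "(\<lambda>y. \<Sum>i\<le>degree p. coeff p i * (y ^ i / exp y)) = (\<lambda>y. poly p y * exp (- y))"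
    by (simp add: poly_altdef exp_minus sum_distrib_right divide_inverse mult.assoc fun_eq_iff)
  ultimately show ?thesis
    by simp
qed

text \<open>With \<open>y = 1 / x\<close> and \<open>dy/dx = - y^2\<close>, the derivative of
  \<open>p(y) exp(- y)\<close> is \<open>y^2 (p(y) - p'(y)) exp(- y)\<close>, again of the form
  polynomial times exponential; at the origin both one-sided difference quotients tend to 0.\<close>

lemma flat_has_deriv:
  "(flat p has_real_derivative flat (monom 1 2 * (p - pderiv p)) x) (at x)"
proof -
  consider "x > 0" | "x < 0" | "x = 0" by linarith
  then show ?thesis
  proof cases
    case 1
    have "((\<lambda>x. poly p (1 / x) * exp (- (1 / x))) has_real_derivative
        flat (monom 1 2 * (p - pderiv p)) x) (at x)"
      using 1
      by (auto intro!: derivative_eq_intros DERIV_chain'[OF _ poly_DERIV]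
          simp: flat_def poly_monom field_simps power2_eq_square)
    moreover have "eventually (\<lambda>y. y \<in> {0<..}) (nhds x)"
      using 1 by (intro eventually_nhds_in_open) auto
    then have "eventually (\<lambda>y. poly p (1 / y) * exp (- (1 / y)) = flat p y) (nhds x)"
      by eventually_elim (simp add: flat_def)
    ultimately show ?thesis
      by (subst (asm) DERIV_cong_ev) auto
  next
    case 2
    have "eventually (\<lambda>y. y \<in> {..<0}) (nhds x)"
      using 2 by (intro eventually_nhds_in_open) auto
    then have "eventually (\<lambda>y. 0 = flat p y) (nhds x)"
      by eventually_elim (simp add: flat_def)
    moreover have "((\<lambda>y. 0) has_real_derivative flat (monom 1 2 * (p - pderiv p)) x) (at x)"
      using 2 by (simp add: flat_def)
    ultimately show ?thesis
      by (subst (asm) DERIV_cong_ev) auto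
  next
    case 3
    \<comment> \<open>Dividing by \<open>h\<close> multiplies the polynomial in \<open>1 / h\<close>
      by its variable, which is what \<open>pCons 0 p\<close> does.\<close>
    have "((\<lambda>h. poly (pCons 0 p) (inverse h) * exp (- inverse h)) \<longlongrightarrow> 0) (at_right (0::real))"
      by (rule filterlim_compose[OF poly_times_exp_minus_tendsto_0 filterlim_inverse_at_top_right])
    then have "((\<lambda>h. flat p h / h) \<longlongrightarrow> 0) (at_right 0)"
      by (rule Lim_transform_eventually)
         (auto intro!: eventually_at_rightI[of _ 1] simp: flat_def field_simps)
    moreover have "((\<lambda>h. flat p h / h) \<longlongrightarrow> 0) (at_left 0)"
      by (rule Lim_transform_eventually[OF tendsto_const])
         (auto intro!: eventually_at_leftI[of "-1"] simp: flat_def)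
    ultimately have "((\<lambda>h. flat p h / h) \<longlongrightarrow> 0) (at 0)"
      by (simp add: filterlim_split_at)
    then show ?thesis
      using 3 by (simp add: has_field_derivative_iff flat_def)
  qed
qed

text \<open>A bump is a product of a left and a right flat function, and the product rule creates
  sums of such products. Closing under both operations gives a family to which
  \<open>smooth_closed_set\<close> applies.\<close>

inductive_set flat_algebra :: "real \<Rightarrow> real \<Rightarrow> (real \<Rightarrow> real) set" for a b where
  left: "(\<lambda>x. flat p (x - a)) \<in> flat_algebra a b"
| right: "(\<lambda>x. flat p (b - x)) \<in> flat_algebra a b"
| add: "f \<in> flat_algebra a b \<Longrightarrow> g \<in> flat_algebra a b \<Longrightarrow> (\<lambda>x. f x + g x) \<in> flat_algebra a b"
| mult: "f \<in> flat_algebra a b \<Longrightarrow> g \<in> flat_algebra a b \<Longrightarrow> (\<lambda>x. f x * g x) \<in> flat_algebra a b"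

lemma flat_algebra_deriv:
  "f \<in> flat_algebra a b \<Longrightarrow> \<exists>g\<in>flat_algebra a b. \<forall>x. (f has_real_derivative g x) (at x)"
proof (induction rule: flat_algebra.induct)
  case (left p)
  have "((\<lambda>x. flat p (x - a)) has_real_derivative flat (monom 1 2 * (p - pderiv p)) (x - a)) (at x)" for x
    by (rule DERIV_cong[OF DERIV_chain'[OF _ flat_has_deriv]]) (auto intro!: derivative_eq_intros)
  then show ?case
    by (intro bexI[OF _ flat_algebra.left]) auto
next
  case (right p)
  \<comment> \<open>The inner slope -1 is absorbed into the polynomial, because \<open>flat\<close>
    is linear in it.\<close>
  have "((\<lambda>x. flat p (b - x)) has_real_derivative flat (- (monom 1 2 * (p - pderiv p))) (b - x)) (at x)" for x
    by (rule DERIV_cong[OF DERIV_chain'[OF _ flat_has_deriv, where D = "-1"]])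
       (auto intro!: derivative_eq_intros simp: flat_def)
  then show ?case
    by (intro bexI[OF _ flat_algebra.right]) auto
next
  case (add f g)
  then obtain f' g' where "f' \<in> flat_algebra a b" "\<And>x. (f has_real_derivative f' x) (at x)"
    "g' \<in> flat_algebra a b" "\<And>x. (g has_real_derivative g' x) (at x)" by blast
  then show ?case
    by (intro bexI[of _ "\<lambda>x. f' x + g' x"])
       (auto intro!: flat_algebra.add DERIV_add)
next
  case (mult f g)
  then obtain f' g' where "f' \<in> flat_algebra a b" "\<And>x. (f has_real_derivative f' x) (at x)"
    "g' \<in> flat_algebra a b" "\<And>x. (g has_real_derivative g' x) (at x)" by blast
  then show ?case
    by (intro bexI[of _ "\<lambda>x. f' x * g x + g' x * f x"])
       (auto intro!: flat_algebra.add flat_algebra.mult mult.hyps DERIV_mult)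
qed

text \<open>\<open>flat 1\<close> is positive exactly on the positive reals, so the product of its
  translate to \<open>a\<close> and its reflection at \<open>b\<close> is positive exactly between
  them.\<close>

lemma smooth_bump_exists:
  "\<exists>f. smooth f \<and> (\<forall>x. 0 \<le> f x) \<and> (\<forall>x. 0 < f x \<longleftrightarrow> a < x \<and> x < b)"
proof (intro exI[of _ "\<lambda>x. flat 1 (x - a) * flat 1 (b - x)"] conjI)
  show "smooth (\<lambda>x. flat 1 (x - a) * flat 1 (b - x))"
    by (rule smooth_closed_set[OF flat_algebra_deriv])
       (auto intro: flat_algebra.intros)
qed (auto simp: flat_def)

text \<open>Steps serve twice: their differences are test functions bounded by 1, and their
  derivatives are nonnegative kernels of mass 1 concentrated on the transition interval.\<close>

definition smooth_step :: "real \<Rightarrow> real \<Rightarrow> (real \<Rightarrow> real) \<Rightarrow> bool" where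
  "smooth_step a b s \<longleftrightarrow> smooth s \<and> (\<forall>x. 0 \<le> deriv s x) \<and> (\<forall>x. 0 \<le> s x \<and> s x \<le> 1) \<and>
     (\<forall>x\<le>a. s x = 0) \<and> (\<forall>x\<ge>b. s x = 1)"

lemma smooth_stepD:
  assumes "smooth_step a b s"
  shows "smooth s" "0 \<le> deriv s x" "0 \<le> s x \<and> s x \<le> 1" "x \<le> a \<Longrightarrow> s x = 0" "b \<le> x \<Longrightarrow> s x = 1"
  using assms by (auto simp: smooth_step_def)

text \<open>The step is the antiderivative of a bump on the transition interval, divided by the
  total mass of the bump.\<close>

lemma smooth_step_exists:
  assumes "a < b"
  shows "\<exists>s. smooth_step a b s"
proof -
  obtain f where f: "smooth f" "\<And>x. 0 \<le> f x" "\<And>x. 0 < f x \<longleftrightarrow> a < x \<and> x < b"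
    using smooth_bump_exists[of a b] by auto
  \<comment> \<open>Starting at \<open>a - 1\<close> instead of \<open>a\<close> makes every
    \<open>x\<close> with \<open>a \<le> x\<close> an interior point of
    \<open>{a - 1..x + 1}\<close>, so the derivative there is two-sided.\<close>
  define F where "F x = integral {a - 1..x} f" for x
  have f0: "f x = 0" if "x \<le> a \<or> b \<le> x" for x
    using f(2)[of x] f(3)[of x] that by auto
  have F0: "F x = 0" if "x \<le> a" for x
  proof -
    have "integral {a - 1..x} f = integral {a - 1..x} (\<lambda>_. 0)"
      by (rule integral_cong) (use that f0 in auto)
    then show ?thesis
      by (simp add: F_def)
  qed
  have F': "(F has_real_derivative f x) (at x)" for x
  proof (cases "x < a")
    case True
    have "eventually (\<lambda>y. y \<in> {..<a}) (nhds x)"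
      using True by (intro eventually_nhds_in_open) auto
    then have "eventually (\<lambda>y. 0 = F y) (nhds x)"
      by eventually_elim (simp add: F0)
    moreover have "((\<lambda>y. 0) has_real_derivative f x) (at x)"
      using True f0 by simp
    ultimately show ?thesis
      by (subst (asm) DERIV_cong_ev) auto
  next
    case False
    then have "(F has_real_derivative f x) (at x within {a - 1..x + 1})"
      unfolding F_def by (intro integral_has_real_derivative smooth_continuous f) auto
    then show ?thesis
      using False by (subst (asm) at_within_interior) auto
  qed
  have "F a < F b"
  proof (rule DERIV_pos_imp_increasing_open[OF assms])
    show "\<exists>y. (F has_real_derivative y) (at x) \<and> 0 < y" if "a < x" "x < b" for x
      using F' f(3) that by blast
    show "continuous_on {a..b} F"
      by (meson DERIV_continuous_on F' has_field_derivative_at_within)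
  qed
  then have pos: "F b > 0"
    using F0 by simp
  have Fb: "F x = F b" if "b \<le> x" for x
  proof (rule DERIV_isconst2[of b "x + 1"])
    show "continuous_on {b..x + 1} F"
      by (meson DERIV_continuous_on F' has_field_derivative_at_within)
    show "(F has_real_derivative 0) (at y)" if "b < y" "y < x + 1" for y
      using F'[of y] f0[of y] that by simp
  qed (use that in auto)
  have "mono F"
  proof (rule monoI)
    show "F x \<le> F y" if "x \<le> y" for x y
      by (rule DERIV_nonneg_imp_nondecreasing[OF that]) (use F' f(2) in blast)
  qed
  then have F01: "0 \<le> F x \<and> F x \<le> F b" for x
    using monoD[of F "min x a" x] monoD[of F x "max x b"] F0[of "min x a"] Fb[of "max x b"] by auto
  show ?thesis
    unfolding smooth_step_def
  proof (intro exI[of _ "\<lambda>x. inverse (F b) * F x"] conjI allI impI)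
    show "0 \<le> inverse (F b) * F x" "inverse (F b) * F x \<le> 1" for x
      using F01[of x] pos by (simp_all add: field_simps)
    show "smooth (\<lambda>x. inverse (F b) * F x)"
      by (intro smooth_cmult smooth_antiderivative[OF F'] f)
    have "deriv (\<lambda>x. inverse (F b) * F x) x = inverse (F b) * f x" for x
      by (intro DERIV_imp_deriv DERIV_cmult F')
    then show "0 \<le> deriv (\<lambda>x. inverse (F b) * F x) x" for x
      using f(2) pos by simp
    show "inverse (F b) * F x = 0" if "x \<le> a" for x
      using F0[OF that] by simp
    show "inverse (F b) * F x = 1" if "b \<le> x" for x
      using Fb[OF that] pos by simp
  qed
qed

section \<open>Pointwise description of L2\<close>

lemma measure_I01 [simp]: "measure I01 {0<..<1} = 1"
  and finite_measure_I01: "finite_measure I01"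
proof -
  show "measure I01 {0<..<1} = 1"
    by (simp add: measure_restrict_space)
  show "finite_measure I01"
    by (rule finite_measureI) (simp add: emeasure_restrict_space)
qed

lemma integrable_const_I01 [simp]: "integrable I01 (\<lambda>x. c :: 'b :: {banach, second_countable_topology})"
  by (rule finite_measure.integrable_const[OF finite_measure_I01])

text \<open>The measure is finite and \<open>t \<le> 1 + t^2\<close>, so the square dominates up to
  an integrable constant.\<close>

lemma square_integrable_imp_integrable:
  assumes "square_integrable f"
  shows "integrable I01 f"
proof (rule Bochner_Integration.integrable_bound)
  show "integrable I01 (\<lambda>x. 1 + (norm (f x))\<^sup>2)"
    using assms by (auto simp: square_integrable_def)
  have "norm (f x) \<le> 1 + (norm (f x))\<^sup>2" for x
    using sum_squares_bound[of 1 "norm (f x)"] norm_ge_zero[of "f x"] by (simp, linarith)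
  then show "AE x in I01. norm (f x) \<le> norm (1 + (norm (f x))\<^sup>2)"
    by simp
qed (use assms in \<open>simp add: square_integrable_def\<close>)

lemma L2_rel_rep: "L2_rel (rep_L2 f) (rep_L2 f)"
  by (rule Quotient_rep_reflp[OF Quotient_L2])

lemma square_integrable_rep: "square_integrable (rep_L2 f)"
  using L2_rel_rep by (simp add: L2_rel_def)

lemma abs_rep_L2: "abs_L2 (rep_L2 f) = f"
  by (rule Quotient_abs_rep[OF Quotient_L2])

lemma rep_abs_L2:
  assumes "square_integrable h"
  shows "AE x in I01. rep_L2 (abs_L2 h) x = h x"
proof -
  have "L2_rel h h"
    using assms by (simp add: L2_rel_def)
  then have "L2_rel (rep_L2 (abs_L2 h)) h"
    by (metis Quotient_L2 Quotient_rep_abs)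
  then show ?thesis
    by (simp add: L2_rel_def)
qed

lemma L2_eqI:
  assumes "AE x in I01. rep_L2 f x = rep_L2 g x"
  shows "f = g"
proof -
  have "L2_rel (rep_L2 f) (rep_L2 g)"
    using assms by (simp add: L2_rel_def square_integrable_rep)
  then show ?thesis
    by (metis Quotient_L2 Quotient_rel_rep)
qed

text \<open>\<open>rep_L2\<close> is an arbitrary choice of representative, so it respects this
  operation and the following ones only almost everywhere.\<close>

lemma rep_L2_add: "AE x in I01. rep_L2 (f + g) x = rep_L2 f x + rep_L2 g x"
  using rep_abs_L2[OF square_integrable_add[OF square_integrable_rep square_integrable_rep]]
  by (simp flip: plus_L2.abs_eq[OF L2_rel_rep L2_rel_rep] add: abs_rep_L2)

lemma rep_L2_diff: "AE x in I01. rep_L2 (f - g) x = rep_L2 f x - rep_L2 g x"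
  using rep_abs_L2[OF square_integrable_diff[OF square_integrable_rep square_integrable_rep]]
  by (simp flip: minus_L2.abs_eq[OF L2_rel_rep L2_rel_rep] add: abs_rep_L2)

lemma rep_L2_scaleC: "AE x in I01. rep_L2 (c *\<^sub>C f) x = c *s rep_L2 f x"
  using rep_abs_L2[OF square_integrable_bounded_linear[OF
      bounded_linear_vector_scalar_mult_complex square_integrable_rep]]
  by (simp flip: scaleC_L2.abs_eq[OF L2_rel_rep] add: abs_rep_L2)

lemma rep_L2_matrix: "AE x in I01. rep_L2 (matrix_L2 A f) x = A *v rep_L2 f x"
  using rep_abs_L2[OF square_integrable_bounded_linear[OF
      bounded_linear_matrix_vector_complex square_integrable_rep]]
  by (simp flip: matrix_L2.abs_eq[OF L2_rel_rep] add: abs_rep_L2)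

lemma norm_L2_power2: "(norm f)\<^sup>2 = (LINT x|I01. (norm (rep_L2 f x))\<^sup>2)"
  by (simp add: power2_norm_eq_inner inner_L2.rep_eq)

lemma integrable_norm_power2_rep: "integrable I01 (\<lambda>x. (norm (rep_L2 f x))\<^sup>2)"
  using square_integrable_rep by (simp add: square_integrable_def)

lemma norm_L2_leI:
  assumes "AE x in I01. norm (rep_L2 f x) \<le> c * norm (rep_L2 g x)" "0 \<le> c"
  shows "norm f \<le> c * norm g"
proof (rule power2_le_imp_le)
  have "(norm f)\<^sup>2 \<le> (LINT x|I01. c\<^sup>2 * (norm (rep_L2 g x))\<^sup>2)"
    unfolding norm_L2_power2
  proof (rule integral_mono_AE)
    show "AE x in I01. (norm (rep_L2 f x))\<^sup>2 \<le> c\<^sup>2 * (norm (rep_L2 g x))\<^sup>2"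
      using assms(1) by eventually_elim (metis norm_ge_zero power_mono power_mult_distrib)
  qed (use integrable_norm_power2_rep in auto)
  then show "(norm f)\<^sup>2 \<le> (c * norm g)\<^sup>2"
    by (simp add: norm_L2_power2 power_mult_distrib)
qed (use assms in auto)

lemma norm_L2_le_const:
  assumes "AE x in I01. norm (rep_L2 f x) \<le> c" "0 \<le> c"
  shows "norm f \<le> c"
proof (rule power2_le_imp_le)
  have "(norm f)\<^sup>2 \<le> (LINT x|I01. c\<^sup>2)"
    unfolding norm_L2_power2
  proof (rule integral_mono_AE)
    show "AE x in I01. (norm (rep_L2 f x))\<^sup>2 \<le> c\<^sup>2"
      using assms(1) by eventually_elim (simp add: power_mono)
  qed (use integrable_norm_power2_rep in auto)
  then show "(norm f)\<^sup>2 \<le> c\<^sup>2"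
    by simp
qed fact

text \<open>As the interval has measure 1, a nonnegative constant is its own norm. This is what
  later turns a bound on the norm into a pointwise bound.\<close>

lemma norm_L2_ge_const:
  assumes "AE x in I01. c \<le> norm (rep_L2 f x)"
  shows "c \<le> norm f"
proof (cases "0 \<le> c")
  case True
  have "(LINT x|I01. c\<^sup>2) \<le> (norm f)\<^sup>2"
    unfolding norm_L2_power2
  proof (rule integral_mono_AE)
    show "AE x in I01. c\<^sup>2 \<le> (norm (rep_L2 f x))\<^sup>2"
      using assms(1) by eventually_elim (simp add: True power_mono)
  qed (use integrable_norm_power2_rep in auto)
  then have "c\<^sup>2 \<le> (norm f)\<^sup>2"
    by simp
  then show ?thesis
    by (rule power2_le_imp_le) simp
next
  case False
  then show ?thesis
    using norm_ge_zero[of f] by linarith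
qed

lemma matrix_L2_bounded: "\<exists>C\<ge>0. \<forall>f. norm (matrix_L2 A f) \<le> C * norm f"
proof -
  obtain C where C: "0 < C" "\<And>v. norm (A *v v) \<le> norm v * C"
    using bounded_linear.pos_bounded[OF bounded_linear_matrix_vector_complex[of A]] by auto
  have "norm (matrix_L2 A f) \<le> C * norm f" for f
  proof (rule norm_L2_leI)
    show "AE x in I01. norm (rep_L2 (matrix_L2 A f) x) \<le> C * norm (rep_L2 f x)"
      using rep_L2_matrix[of A f] by eventually_elim (use C(2) in \<open>simp add: mult.commute\<close>)
  qed (use C in simp)
  then show ?thesis
    using C(1) by (intro exI[of _ C]) auto
qed

lemma scaleC_L2_bounded: "\<exists>C\<ge>0. \<forall>f. norm (c *\<^sub>C f) \<le> C * norm f"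
proof -
  obtain C where C: "0 < C" "\<And>v :: complex^2. norm (c *s v) \<le> norm v * C"
    using bounded_linear.pos_bounded[OF bounded_linear_vector_scalar_mult_complex[of c]] by auto
  have "norm (c *\<^sub>C f) \<le> C * norm f" for f
  proof (rule norm_L2_leI)
    show "AE x in I01. norm (rep_L2 (c *\<^sub>C f) x) \<le> C * norm (rep_L2 f x)"
      using rep_L2_scaleC[of c f] by eventually_elim (use C(2) in \<open>simp add: mult.commute\<close>)
  qed (use C in simp)
  then show ?thesis
    using C(1) by (intro exI[of _ C]) auto
qed

section \<open>Algebra of the matrix action and of complex scalars on \<open>L2\<close>\<close>

lemma matrix_L2_add: "matrix_L2 A (f + g) = matrix_L2 A f + matrix_L2 A g"
proof (rule L2_eqI)
  show "AE x in I01. rep_L2 (matrix_L2 A (f + g)) x = rep_L2 (matrix_L2 A f + matrix_L2 A g) x"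
    using rep_L2_matrix[of A "f + g"] rep_L2_add[of f g] rep_L2_matrix[of A f] rep_L2_matrix[of A g]
      rep_L2_add[of "matrix_L2 A f" "matrix_L2 A g"]
    by eventually_elim (simp add: matrix_vector_right_distrib)
qed

lemma matrix_L2_scaleC: "matrix_L2 A (c *\<^sub>C f) = c *\<^sub>C matrix_L2 A f"
proof (rule L2_eqI)
  show "AE x in I01. rep_L2 (matrix_L2 A (c *\<^sub>C f)) x = rep_L2 (c *\<^sub>C matrix_L2 A f) x"
    using rep_L2_matrix[of A "c *\<^sub>C f"] rep_L2_scaleC[of c f] rep_L2_matrix[of A f]
      rep_L2_scaleC[of c "matrix_L2 A f"]
    by eventually_elim (simp add: vector_scalar_commute)
qed

lemma matrix_L2_mult: "matrix_L2 A (matrix_L2 B f) = matrix_L2 (A ** B) f"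
proof (rule L2_eqI)
  show "AE x in I01. rep_L2 (matrix_L2 A (matrix_L2 B f)) x = rep_L2 (matrix_L2 (A ** B) f) x"
    using rep_L2_matrix[of A "matrix_L2 B f"] rep_L2_matrix[of B f] rep_L2_matrix[of "A ** B" f]
    by eventually_elim (simp add: matrix_vector_mul_assoc)
qed

lemma matrix_L2_one: "matrix_L2 (mat 1) f = f"
  by (rule L2_eqI, use rep_L2_matrix[of "mat 1" f] in eventually_elim) simp

lemma scaleC_L2_add: "c *\<^sub>C (f + g) = c *\<^sub>C f + c *\<^sub>C g"
proof (rule L2_eqI)
  show "AE x in I01. rep_L2 (c *\<^sub>C (f + g)) x = rep_L2 (c *\<^sub>C f + c *\<^sub>C g) x"
    using rep_L2_scaleC[of c "f + g"] rep_L2_add[of f g] rep_L2_scaleC[of c f] rep_L2_scaleC[of c g]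
      rep_L2_add[of "c *\<^sub>C f" "c *\<^sub>C g"]
    by eventually_elim (simp add: vector_add_ldistrib)
qed

lemma scaleC_L2_diff: "c *\<^sub>C (f - g) = c *\<^sub>C f - c *\<^sub>C g"
  using scaleC_L2_add[of c "f - g" g] by simp

lemma scaleC_L2_uminus: "c *\<^sub>C (- f) = - (c *\<^sub>C f)"
  using scaleC_L2_diff[of c 0 f] scaleC_L2_diff[of c f f] by simp

lemma scaleC_L2_commute: "c *\<^sub>C d *\<^sub>C f = d *\<^sub>C c *\<^sub>C f"
proof (rule L2_eqI)
  show "AE x in I01. rep_L2 (c *\<^sub>C d *\<^sub>C f) x = rep_L2 (d *\<^sub>C c *\<^sub>C f) x"
    using rep_L2_scaleC[of c "d *\<^sub>C f"] rep_L2_scaleC[of d "c *\<^sub>C f"]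
      rep_L2_scaleC[of c f] rep_L2_scaleC[of d f]
    by eventually_elim (simp add: vector_smult_assoc mult.commute)
qed

text \<open>The integral is at most the mean of \<open>norm g\<close>, and on a space of measure 1
  the mean is at most the root mean square.\<close>

lemma norm_integral_le_norm_L2:
  assumes "\<And>x. x \<in> {0<..<1} \<Longrightarrow> \<bar>\<eta> x\<bar> \<le> 1"
  shows "norm (LINT x|I01. \<eta> x *\<^sub>R rep_L2 g x) \<le> norm g"
proof -
  let ?m = "LINT x|I01. norm (rep_L2 g x)"
  have int: "integrable I01 (\<lambda>x. norm (rep_L2 g x))"
    by (intro integrable_norm square_integrable_imp_integrable square_integrable_rep)
  have "norm (LINT x|I01. \<eta> x *\<^sub>R rep_L2 g x) \<le> ?m"
  proof (rule order_trans[OF integral_norm_bound integral_mono'])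
    show "norm (\<eta> x *\<^sub>R rep_L2 g x) \<le> norm (rep_L2 g x)" if "x \<in> space I01" for x
      using assms that by (auto intro: mult_left_le_one_le)
  qed (use int in auto)
  also have "?m \<le> norm g"
  proof (rule power2_le_imp_le)
    \<comment> \<open>The variance about the mean \<open>?m\<close> is nonnegative; expanding it
      gives the comparison of the two means.\<close>
    have "0 \<le> (LINT x|I01. (norm (rep_L2 g x) - ?m)\<^sup>2)"
      by (rule Bochner_Integration.integral_nonneg) simp
    also have "\<dots> = (LINT x|I01. (norm (rep_L2 g x))\<^sup>2 - 2 * ?m * norm (rep_L2 g x) + ?m\<^sup>2)"
      by (simp add: power2_diff algebra_simps)
    also have "\<dots> = (norm g)\<^sup>2 - 2 * ?m * ?m + ?m\<^sup>2"
      using int integrable_norm_power2_rep[of g] by (simp add: norm_L2_power2)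
    finally show "?m\<^sup>2 \<le> (norm g)\<^sup>2"
      by (simp add: power2_eq_square)
  qed simp
  finally show ?thesis .
qed

section \<open>Test functions and weak second derivatives\<close>

lemma continuous_times_integrable_I01:
  fixes h :: "real \<Rightarrow> complex^2"
  assumes "continuous_on {0..1} \<eta>" "integrable I01 h"
  shows "integrable I01 (\<lambda>x. \<eta> x *\<^sub>R h x)"
proof -
  have "compact (\<eta> ` {0..1})"
    by (rule compact_continuous_image[OF assms(1)]) simp
  then obtain C where C: "\<And>x. x \<in> {0..1} \<Longrightarrow> \<bar>\<eta> x\<bar> \<le> C"
    using compact_imp_bounded[of "\<eta> ` {0..1}"] unfolding bounded_iff by fastforce
  have "integrable I01 (\<lambda>x. C * norm (h x))"
    using assms(2) by auto
  then show ?thesis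
  proof (rule Bochner_Integration.integrable_bound)
    have "\<eta> \<in> borel_measurable I01"
      by (rule continuous_imp_measurable_on_sets_lebesgue)
         (auto intro: continuous_on_subset[OF assms(1)])
    then show "(\<lambda>x. \<eta> x *\<^sub>R h x) \<in> borel_measurable I01"
      using assms(2) by measurable
    show "AE x in I01. norm (\<eta> x *\<^sub>R h x) \<le> norm (C * norm (h x))"
    proof (rule AE_I2)
      fix x assume "x \<in> space I01"
      then have "\<bar>\<eta> x\<bar> \<le> C"
        by (intro C) simp
      then show "norm (\<eta> x *\<^sub>R h x) \<le> norm (C * norm (h x))"
        by (simp add: abs_mult mult_right_mono)
    qed
  qed
qed

lemma test_function_smooth: "test_function \<eta> \<Longrightarrow> smooth \<eta>"
  by (simp add: test_function_def smooth_def)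

text \<open>A step is not compactly supported, but two steps agree to the left and to the right of
  their transitions. The test functions constructed below are all such differences.\<close>

lemma test_function_step_diff:
  assumes "smooth s" "smooth t" "0 < a" "b < 1" "\<And>x. x \<le> a \<or> b \<le> x \<Longrightarrow> s x = t x"
  shows "test_function (\<lambda>x. s x - t x)"
  unfolding test_function_def
proof
  show "\<forall>n x. (deriv ^^ n) (\<lambda>x. s x - t x) field_differentiable (at x)"
    using smooth_diff[OF assms(1,2)] by (simp add: smooth_def)
  show "\<exists>K. compact K \<and> K \<subseteq> {0<..<1} \<and> (\<forall>x. x \<notin> K \<longrightarrow> s x - t x = 0)"
    by (rule exI[of _ "{a..b}"]) (use assms(3-5) in auto)
qed

text \<open>The sets over which the integral vanishes contain the closed intervals and are stable
  under complements, by \<open>U\<close>, and under disjoint countable unions, by countable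
  additivity; hence they include all Borel sets.\<close>

lemma integral_lebesgue_borel_set_eq_0:
  fixes k :: "real \<Rightarrow> 'b::{banach, second_countable_topology}"
  assumes k: "integrable lebesgue k" and I: "\<And>a b. a \<le> b \<Longrightarrow> (LINT x:{a..b}|lebesgue. k x) = 0"
    and U: "(LINT x|lebesgue. k x) = 0" and A: "A \<in> sets borel"
  shows "(LINT x:A|lebesgue. k x) = 0"
  using A
proof (induction rule: borel_set_induct)
  case empty
  then show ?case by (simp add: set_lebesgue_integral_def)
next
  case (interval a b)
  then show ?case by (rule I)
next
  case (compl A)
  have iA: "integrable lebesgue (\<lambda>x. indicat_real A x *\<^sub>R k x)"
    using compl by (intro integrable_mult_indicator k) auto
  have "(LINT x:-A|lebesgue. k x) = (LINT x|lebesgue. k x - indicat_real A x *\<^sub>R k x)"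
    unfolding set_lebesgue_integral_def
    by (rule Bochner_Integration.integral_cong) (auto simp: indicator_def)
  also have "\<dots> = 0"
    using Bochner_Integration.integral_diff[OF k iA] U compl by (simp add: set_lebesgue_integral_def)
  finally show ?case .
next
  case (union A)
  have "(LINT x:(\<Union>i. A i)|lebesgue. k x) = (\<Sum>i. LINT x:A i|lebesgue. k x)"
  proof (rule lebesgue_integral_countable_add)
    show "set_integrable lebesgue (\<Union>i. A i) k"
      unfolding set_integrable_def
      by (intro integrable_mult_indicator k sets.countable_UN) (use union in auto)
  qed (use union in \<open>auto simp: disjoint_family_on_def\<close>)
  then show ?case
    using union by simp
qed

text \<open>Completion does not change the measure of Borel sets, so a countable cover by Borel sets
  of finite measure carries over.\<close>

lemma sigma_finite_lebesgue: "sigma_finite_measure (lebesgue :: 'a::euclidean_space measure)"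
proof
  obtain A :: "'a set set" where "countable A" "A \<subseteq> sets lborel" "\<Union>A = space lborel"
    "\<forall>a\<in>A. emeasure lborel a \<noteq> \<infinity>"
    using sigma_finite_measure.sigma_finite_countable[OF sigma_finite_lborel] by blast
  then show "\<exists>A :: 'a set set. countable A \<and> A \<subseteq> sets lebesgue \<and> \<Union>A = space lebesgue \<and>
      (\<forall>a\<in>A. emeasure lebesgue a \<noteq> \<infinity>)"
    by (intro exI[of _ A]) (auto simp: emeasure_completion subset_iff)
qed

lemma AE_zero_of_integral_intervals_zero:
  fixes k :: "real \<Rightarrow> 'b::{banach, second_countable_topology}"
  assumes k: "integrable lebesgue k" and I: "\<And>a b. a \<le> b \<Longrightarrow> (LINT x:{a..b}|lebesgue. k x) = 0"
    and U: "(LINT x|lebesgue. k x) = 0"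
  shows "AE x in lebesgue. k x = 0"
proof (rule sigma_finite_measure.density_zero[OF sigma_finite_lebesgue k])
  fix A :: "real set" assume "A \<in> sets lebesgue"
  \<comment> \<open>A Lebesgue measurable set is a Borel set up to a null set, which reduces the
    claim to the Borel case.\<close>
  then obtain S N N' where A: "A = S \<union> N" "N \<subseteq> N'" "N' \<in> null_sets lborel" "S \<in> sets lborel"
    by (rule sets_completionE)
  have "AE x in lebesgue. x \<notin> N'"
    using A(3) by (intro AE_not_in null_sets_completionI)
  then have "AE x in lebesgue. indicat_real A x *\<^sub>R k x = indicat_real S x *\<^sub>R k x"
    by eventually_elim (use A in \<open>auto simp: indicator_def\<close>)
  then have "(LINT x:A|lebesgue. k x) = (LINT x:S|lebesgue. k x)"
    unfolding set_lebesgue_integral_def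
    by (intro integral_cong_AE borel_measurable_scaleR borel_measurable_indicator
        borel_measurable_integrable[OF k]) (use A \<open>A \<in> sets lebesgue\<close> in auto)
  also have "\<dots> = 0"
    using integral_lebesgue_borel_set_eq_0[OF k I U] A(4) by simp
  finally show "(LINT x:A|lebesgue. k x) = 0" .
qed

text \<open>The indicator of the open interval is a pointwise limit of test functions bounded by 1,
  so dominated convergence with majorant \<open>norm (k x)\<close> applies.\<close>

lemma integral_interval_zero_of_test_functions:
  fixes k :: "real \<Rightarrow> complex^2"
  assumes k: "integrable I01 k"
    and test: "\<And>\<eta>. test_function \<eta> \<Longrightarrow> (LINT x|I01. \<eta> x *\<^sub>R k x) = 0"
    and ab: "0 \<le> a" "a < b" "b \<le> 1"
  shows "(LINT x|I01. indicat_real {a<..<b} x *\<^sub>R k x) = 0"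
proof -
  \<comment> \<open>The approximants rise on \<open>[a + d, a + 2 d]\<close> and fall on
    \<open>[b - 2 d, b - d]\<close>. The bound \<open>3 * d n \<le> b - a\<close>, ensured by the 3,
    keeps the two steps equal before \<open>a + d\<close> and after \<open>b - d\<close>; the margin
    \<open>d\<close> keeps the support compact inside the unit interval even when
    \<open>a = 0\<close> or \<open>b = 1\<close>.\<close>
  define d where "d n = (b - a) / (real n + 3)" for n
  have d: "0 < d n" "3 * d n \<le> b - a" for n
    using ab mult_right_mono[of a b "real n"] by (auto simp: d_def field_simps)
  have d0: "d \<longlonglongrightarrow> 0"
    unfolding d_def by real_asymp
  have "\<exists>\<eta>. test_function \<eta> \<and> (\<forall>x. \<bar>\<eta> x\<bar> \<le> 1) \<and> (\<forall>x. x \<notin> {a<..<b} \<longrightarrow> \<eta> x = 0) \<and>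
      (\<forall>x. a + 2 * d n \<le> x \<and> x \<le> b - 2 * d n \<longrightarrow> \<eta> x = 1)" for n
  proof -
    have lt: "a + d n < a + 2 * d n" "b - 2 * d n < b - d n"
      using d(1)[of n] by simp_all
    obtain s t where st: "smooth_step (a + d n) (a + 2 * d n) s" "smooth_step (b - 2 * d n) (b - d n) t"
      using smooth_step_exists[OF lt(1)] smooth_step_exists[OF lt(2)] by blast
    note s = smooth_stepD[OF st(1)] and t = smooth_stepD[OF st(2)]
    have eq: "s x = t x" if "x \<le> a + d n \<or> b - d n \<le> x" for x
      using that d[of n] s(4,5)[of x] t(4,5)[of x] by auto
    have "\<bar>s x - t x\<bar> \<le> 1" for x
      using s(3)[of x] t(3)[of x] by linarith
    moreover have "test_function (\<lambda>x. s x - t x)"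
      by (rule test_function_step_diff[OF s(1) t(1) _ _ eq]) (use ab d(1)[of n] in auto)
    moreover have "s x - t x = 0" if "x \<notin> {a<..<b}" for x
      using eq[of x] d(1)[of n] that by auto
    ultimately show ?thesis
      using s(5) t(4) by (intro exI[of _ "\<lambda>x. s x - t x"]) auto
  qed
  then obtain \<eta> where \<eta>: "\<And>n. test_function (\<eta> n)" "\<And>n x. \<bar>\<eta> n x\<bar> \<le> 1"
      "\<And>n x. x \<notin> {a<..<b} \<Longrightarrow> \<eta> n x = 0"
      "\<And>n x. a + 2 * d n \<le> x \<Longrightarrow> x \<le> b - 2 * d n \<Longrightarrow> \<eta> n x = 1"
    by metis
  have lim: "(\<lambda>n. \<eta> n x) \<longlonglongrightarrow> indicat_real {a<..<b} x" for x
  proof (cases "x \<in> {a<..<b}")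
    case True
    define e where "e = min (x - a) (b - x) / 2"
    have "0 < e"
      using True by (auto simp: e_def)
    then have "eventually (\<lambda>n. d n < e) sequentially"
      using order_tendstoD(2)[OF d0] by blast
    then have "eventually (\<lambda>n. indicat_real {a<..<b} x = \<eta> n x) sequentially"
      by eventually_elim (use True \<eta>(4)[of _ x] in \<open>auto simp: e_def\<close>)
    then show ?thesis
      by (rule Lim_transform_eventually[OF tendsto_const])
  qed (use \<eta>(3) in auto)
  have "(\<lambda>n. LINT x|I01. \<eta> n x *\<^sub>R k x) \<longlonglongrightarrow> (LINT x|I01. indicat_real {a<..<b} x *\<^sub>R k x)"
  proof (rule integral_dominated_convergence[where w = "\<lambda>x. norm (k x)"])
    show "(\<lambda>x. indicat_real {a<..<b} x *\<^sub>R k x) \<in> borel_measurable I01"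
      using ab by (intro borel_measurable_scaleR borel_measurable_indicator borel_measurable_integrable[OF k])
        (auto simp: sets_restrict_space image_iff intro!: bexI[of _ "{a<..<b}"])
    show "(\<lambda>x. \<eta> n x *\<^sub>R k x) \<in> borel_measurable I01" for n
      by (intro borel_measurable_integrable continuous_times_integrable_I01 k smooth_continuous
          test_function_smooth \<eta>)
    show "AE x in I01. norm (\<eta> n x *\<^sub>R k x) \<le> norm (k x)" for n
      by (rule AE_I2) (simp add: \<eta>(2) mult_left_le_one_le)
    show "AE x in I01. (\<lambda>n. \<eta> n x *\<^sub>R k x) \<longlonglongrightarrow> indicat_real {a<..<b} x *\<^sub>R k x"
      by (intro AE_I2 tendsto_scaleR lim tendsto_const)
  qed (use k in simp)
  then show ?thesis
    unfolding test[OF \<eta>(1)] by (rule LIMSEQ_unique[OF _ tendsto_const])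
qed

text \<open>The fundamental lemma of the calculus of variations. The function is extended by zero to
  the whole line, so that the criterion by integrals over intervals becomes available.\<close>

lemma AE_zero_of_test_functions:
  fixes k :: "real \<Rightarrow> complex^2"
  assumes k: "integrable I01 k"
    and test: "\<And>\<eta>. test_function \<eta> \<Longrightarrow> (LINT x|I01. \<eta> x *\<^sub>R k x) = 0"
  shows "AE x in I01. k x = 0"
proof -
  define k0 where "k0 x = indicat_real {0<..<1} x *\<^sub>R k x" for x
  have k0: "integrable lebesgue k0"
    unfolding k0_def using k by (subst (asm) integrable_restrict_space) auto
  have I: "(LINT x:{a..b}|lebesgue. k0 x) = 0" for a b
  proof (cases "max a 0 < min b 1")
    case True
    let ?a = "max a 0" and ?b = "min b 1"
    have "AE x in lebesgue. x \<notin> {a, b}"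
      by (intro AE_not_in negligible_iff_null_sets[THEN iffD1] negligible_finite) simp
    \<comment> \<open>\<open>{a..b}\<close> and its trimmed open version differ inside the unit
      interval at most at \<open>a\<close> and \<open>b\<close>, a null set, and \<open>k0\<close>
      vanishes outside.\<close>
    then have "AE x in lebesgue. indicat_real {a..b} x *\<^sub>R k0 x
        = indicat_real {0<..<1} x *\<^sub>R indicat_real {?a<..<?b} x *\<^sub>R k x"
      by eventually_elim (auto simp: k0_def indicator_def)
    then have "(LINT x:{a..b}|lebesgue. k0 x)
        = (LINT x|lebesgue. indicat_real {0<..<1} x *\<^sub>R indicat_real {?a<..<?b} x *\<^sub>R k x)"
      unfolding set_lebesgue_integral_def
    proof (rule integral_cong_AE[rotated 2])
      have "(\<lambda>x. indicat_real {?a<..<?b} x *\<^sub>R k0 x) \<in> borel_measurable lebesgue"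
        by (intro borel_measurable_integrable integrable_mult_indicator k0) auto
      then show "(\<lambda>x. indicat_real {0<..<1} x *\<^sub>R indicat_real {?a<..<?b} x *\<^sub>R k x)
          \<in> borel_measurable lebesgue"
        by (simp add: k0_def mult.commute)
    qed (intro borel_measurable_integrable integrable_mult_indicator k0, auto)
    also have "\<dots> = (LINT x|I01. indicat_real {?a<..<?b} x *\<^sub>R k x)"
      by (subst integral_restrict_space) auto
    also have "\<dots> = 0"
      by (rule integral_interval_zero_of_test_functions[OF k test]) (use True in auto)
    finally show ?thesis .
  next
    case False
    have "AE x in lebesgue. x \<notin> {a, b}"
      by (intro AE_not_in negligible_iff_null_sets[THEN iffD1] negligible_finite) simp
    then have "AE x in lebesgue. indicat_real {a..b} x *\<^sub>R k0 x = 0"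
      by eventually_elim (use False in \<open>auto simp: k0_def indicator_def\<close>)
    then show ?thesis
      unfolding set_lebesgue_integral_def by (rule integral_eq_zero_AE)
  qed
  have "(LINT x|lebesgue. k0 x) = (LINT x:{0..1}|lebesgue. k0 x)"
    unfolding set_lebesgue_integral_def k0_def
    by (rule Bochner_Integration.integral_cong) (auto simp: indicator_def)
  then have "AE x in lebesgue. k0 x = 0"
    using AE_zero_of_integral_intervals_zero[OF k0 I] I by simp
  then show ?thesis
    by (subst AE_restrict_space_iff) (auto simp: k0_def elim!: eventually_mono)
qed

section \<open>Uniqueness and linearity of the weak second derivative\<close>

lemma weak_second_derivD:
  "weak_second_deriv f g \<Longrightarrow> test_function \<eta> \<Longrightarrow>
    (LINT x|I01. (deriv ^^ 2) \<eta> x *\<^sub>R rep_L2 f x) = (LINT x|I01. \<eta> x *\<^sub>R rep_L2 g x)"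
  by (simp add: weak_second_deriv_def)

text \<open>The difference of two candidates integrates to zero against every test function. This
  gives meaning to the \<open>THE\<close> in \<open>second_deriv\<close>.\<close>

lemma weak_second_deriv_unique:
  assumes "weak_second_deriv f g" "weak_second_deriv f h"
  shows "g = h"
proof (rule L2_eqI)
  have int: "integrable I01 (rep_L2 g)" "integrable I01 (rep_L2 h)"
    by (simp_all add: square_integrable_imp_integrable square_integrable_rep)
  have "AE x in I01. rep_L2 g x - rep_L2 h x = 0"
  proof (rule AE_zero_of_test_functions)
    fix \<eta> assume \<eta>: "test_function \<eta>"
    have "(LINT x|I01. \<eta> x *\<^sub>R rep_L2 g x) = (LINT x|I01. \<eta> x *\<^sub>R rep_L2 h x)"
      using weak_second_derivD[OF assms(1) \<eta>] weak_second_derivD[OF assms(2) \<eta>] by (rule trans[OF sym])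
    then show "(LINT x|I01. \<eta> x *\<^sub>R (rep_L2 g x - rep_L2 h x)) = 0"
      using int \<eta> by (simp add: scaleR_diff_right continuous_times_integrable_I01 smooth_continuous
          test_function_smooth)
  qed (use int in simp)
  then show "AE x in I01. rep_L2 g x = rep_L2 h x"
    by simp
qed

lemma second_deriv_eq: "weak_second_deriv f g \<Longrightarrow> second_deriv f = g"
  unfolding second_deriv_def by (blast intro: the_equality weak_second_deriv_unique)

lemma smooth_deriv2: "smooth \<eta> \<Longrightarrow> smooth ((deriv ^^ 2) \<eta>)"
  by (simp add: numeral_2_eq_2 smooth_deriv)

lemma weak_second_deriv_add:
  assumes "weak_second_deriv f g" "weak_second_deriv f' g'"
  shows "weak_second_deriv (f + f') (g + g')"
proof -
  \<comment> \<open>Stated for smooth weights rather than test functions, so that it rewrites both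
    sides of the weak equation: the weight is \<open>(deriv ^^ 2) \<eta>\<close> on the left and
    \<open>\<eta>\<close> on the right.\<close>
  have *: "(LINT x|I01. \<eta> x *\<^sub>R rep_L2 (h + h') x)
      = (LINT x|I01. \<eta> x *\<^sub>R rep_L2 h x) + (LINT x|I01. \<eta> x *\<^sub>R rep_L2 h' x)"
    if "smooth \<eta>" for \<eta> h h'
  proof -
    have int: "integrable I01 (\<lambda>x. \<eta> x *\<^sub>R rep_L2 k x)" for k
      by (intro continuous_times_integrable_I01 smooth_continuous that square_integrable_imp_integrable
          square_integrable_rep)
    have "AE x in I01. \<eta> x *\<^sub>R rep_L2 (h + h') x = \<eta> x *\<^sub>R rep_L2 h x + \<eta> x *\<^sub>R rep_L2 h' x"
      using rep_L2_add[of h h'] by eventually_elim (simp add: scaleR_add_right)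
    then have "(LINT x|I01. \<eta> x *\<^sub>R rep_L2 (h + h') x)
        = (LINT x|I01. \<eta> x *\<^sub>R rep_L2 h x + \<eta> x *\<^sub>R rep_L2 h' x)"
      by (rule integral_cong_AE[rotated 2])
         (intro borel_measurable_integrable int Bochner_Integration.integrable_add)+
    then show ?thesis
      using int by simp
  qed
  show ?thesis
    using assms unfolding weak_second_deriv_def
    by (simp add: * test_function_smooth smooth_deriv2)
qed

lemma weak_second_deriv_scaleC:
  assumes "weak_second_deriv f g"
  shows "weak_second_deriv (c *\<^sub>C f) (c *\<^sub>C g)"
proof -
  have *: "(LINT x|I01. \<eta> x *\<^sub>R rep_L2 (c *\<^sub>C h) x) = c *s (LINT x|I01. \<eta> x *\<^sub>R rep_L2 h x)"
    if "smooth \<eta>" for \<eta> h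
  proof -
    have int: "integrable I01 (\<lambda>x. \<eta> x *\<^sub>R rep_L2 k x)" for k
      by (intro continuous_times_integrable_I01 smooth_continuous that square_integrable_imp_integrable
          square_integrable_rep)
    have bl: "bounded_linear (\<lambda>v::complex^2. c *s v)"
      by (rule bounded_linear_vector_scalar_mult_complex)
    have "AE x in I01. \<eta> x *\<^sub>R rep_L2 (c *\<^sub>C h) x = c *s (\<eta> x *\<^sub>R rep_L2 h x)"
      using rep_L2_scaleC[of c h]
      by eventually_elim (simp add: linear_scale[OF bounded_linear.linear[OF bl]])
    then have "(LINT x|I01. \<eta> x *\<^sub>R rep_L2 (c *\<^sub>C h) x)
        = (LINT x|I01. c *s (\<eta> x *\<^sub>R rep_L2 h x))"
      by (rule integral_cong_AE[rotated 2])
         (intro borel_measurable_integrable int integrable_bounded_linear[OF bl])+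
    then show ?thesis
      using integral_bounded_linear[OF bl int] by simp
  qed
  show ?thesis
    using assms unfolding weak_second_deriv_def
    by (simp add: * test_function_smooth smooth_deriv2)
qed

section \<open>Bounds on the continuously differentiable representative\<close>

text \<open>Passes from the Lebesgue integral on the open interval to the gauge integral on the
  closed one, where the fundamental theorem of calculus is available.\<close>

lemma continuous_integrable_I01:
  fixes F :: "real \<Rightarrow> 'b::euclidean_space"
  assumes "continuous_on {0..1} F"
  shows "integrable I01 F" "(LINT x|I01. F x) = integral {0..1} F"
proof -
  have "integrable (lebesgue_on {0..1}) F"
    using continuous_imp_integrable[of 0 1 F] assms by simp
  then have "set_integrable lebesgue {0..1} F"
    by (simp add: integrable_restrict_space set_integrable_def)
  then have "set_integrable lebesgue {0<..<1} F"
    by (rule set_integrable_subset) auto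
  then show *: "integrable I01 F"
    by (simp add: integrable_restrict_space set_integrable_def)
  show "(LINT x|I01. F x) = integral {0..1} F"
    using lebesgue_integral_eq_integral[OF *] by (simp add: integral_open_interval_real)
qed

text \<open>The complement of the support is open and contains \<open>x\<close>, so
  \<open>\<eta>\<close> vanishes near \<open>x\<close>. This removes the boundary terms in the
  integration by parts.\<close>

lemma test_function_boundary:
  assumes "test_function \<eta>" "x \<le> 0 \<or> 1 \<le> x"
  shows "deriv \<eta> x = 0"
proof -
  obtain K where K: "compact K" "K \<subseteq> {0<..<1}" "\<And>x. x \<notin> K \<Longrightarrow> \<eta> x = 0"
    using assms(1) unfolding test_function_def by blast
  have "eventually (\<lambda>y. y \<in> - K) (nhds x)"
    using K(1,2) assms(2) by (intro eventually_nhds_in_open) (auto intro: compact_imp_closed)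
  then have "eventually (\<lambda>y. \<eta> y = 0) (nhds x)"
    by eventually_elim (simp add: K(3))
  then have "deriv \<eta> x = deriv (\<lambda>_. 0) x"
    by (rule deriv_cong_ev) simp
  then show ?thesis
    by simp
qed

text \<open>The derivative of \<open>deriv \<eta> t *\<^sub>R u t\<close> integrates to zero. Only
  one derivative is moved, since \<open>u\<close> is merely continuously differentiable.\<close>

lemma integral_by_parts_test_function:
  fixes u :: "real \<Rightarrow> complex^2"
  assumes \<eta>: "test_function \<eta>"
    and u: "\<And>x. x \<in> {0..1} \<Longrightarrow> (u has_vector_derivative u' x) (at x within {0..1})"
    and u': "continuous_on {0..1} u'"
  shows "(LINT x|I01. (deriv ^^ 2) \<eta> x *\<^sub>R u x) = - (LINT x|I01. deriv \<eta> x *\<^sub>R u' x)"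
proof -
  have sm: "smooth (deriv \<eta>)" "smooth ((deriv ^^ 2) \<eta>)"
    using \<eta> by (simp_all add: test_function_smooth smooth_deriv smooth_deriv2)
  have cu: "continuous_on {0..1} u"
    using u by (meson continuous_on_eq_continuous_within has_vector_derivative_continuous)
  have int: "integrable I01 (\<lambda>x. deriv \<eta> x *\<^sub>R u' x)" "integrable I01 (\<lambda>x. (deriv ^^ 2) \<eta> x *\<^sub>R u x)"
    by (intro continuous_integrable_I01 continuous_on_scaleR smooth_continuous sm cu u')+
  have "((\<lambda>x. deriv \<eta> x *\<^sub>R u' x + (deriv ^^ 2) \<eta> x *\<^sub>R u x) has_integral
      deriv \<eta> 1 *\<^sub>R u 1 - deriv \<eta> 0 *\<^sub>R u 0) {0..1}"
  proof (rule fundamental_theorem_of_calculus)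
    fix x :: real assume x: "x \<in> {0..1}"
    have "(deriv \<eta> has_real_derivative (deriv ^^ 2) \<eta> x) (at x within {0..1})"
      using smooth_has_deriv[OF sm(1)] by (simp add: numeral_2_eq_2 has_field_derivative_at_within)
    then show "((\<lambda>x. deriv \<eta> x *\<^sub>R u x) has_vector_derivative
        deriv \<eta> x *\<^sub>R u' x + (deriv ^^ 2) \<eta> x *\<^sub>R u x) (at x within {0..1})"
      by (rule has_vector_derivative_scaleR) (rule u[OF x])
  qed simp
  then have "integral {0..1} (\<lambda>x. deriv \<eta> x *\<^sub>R u' x + (deriv ^^ 2) \<eta> x *\<^sub>R u x) = 0"
    using test_function_boundary[OF \<eta>] by (simp add: integral_unique)
  moreover have "(LINT x|I01. deriv \<eta> x *\<^sub>R u' x + (deriv ^^ 2) \<eta> x *\<^sub>R u x)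
      = integral {0..1} (\<lambda>x. deriv \<eta> x *\<^sub>R u' x + (deriv ^^ 2) \<eta> x *\<^sub>R u x)"
    by (intro continuous_integrable_I01 continuous_intros smooth_continuous sm cu u')
  ultimately have "(LINT x|I01. deriv \<eta> x *\<^sub>R u' x + (deriv ^^ 2) \<eta> x *\<^sub>R u x) = 0"
    by (rule trans[rotated])
  then show ?thesis
    using int by (simp add: add_eq_0_iff)
qed

text \<open>The derivative of the step is nonnegative, has mass 1 and lives on
  \<open>[x - d, x + d]\<close>: integrating against it averages \<open>v\<close> over a window
  where \<open>v\<close> is within \<open>e\<close> of \<open>v x\<close>.\<close>

lemma integral_deriv_step_approx:
  fixes v :: "real \<Rightarrow> complex^2"
  assumes step: "smooth_step (x - d) (x + d) s"
    and v: "continuous_on {0..1} v" "\<And>t. t \<in> {0..1} \<Longrightarrow> \<bar>t - x\<bar> \<le> d \<Longrightarrow> norm (v t - v x) \<le> e"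
    and x: "0 < x - d" "x + d < 1"
  shows "norm ((LINT t|I01. deriv s t *\<^sub>R v t) - v x) \<le> e"
proof -
  note s = smooth_stepD[OF step]
  have cs: "continuous_on {0..1} (deriv s)"
    by (intro smooth_continuous smooth_deriv s)
  have s': "deriv s t = 0" if "\<bar>t - x\<bar> > d" for t
  proof -
    have "eventually (\<lambda>y. s y = s t) (nhds t)"
    proof (cases "t < x - d")
      case True
      have "eventually (\<lambda>y. y \<in> {..<x - d}) (nhds t)"
        using True by (intro eventually_nhds_in_open) auto
      then show ?thesis
        by eventually_elim (use True s(4) in simp)
    next
      case False
      then have t: "x + d < t"
        using that by linarith
      have "eventually (\<lambda>y. y \<in> {x + d<..}) (nhds t)"
        using t by (intro eventually_nhds_in_open) auto
      then show ?thesis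
        by eventually_elim (use t s(5) in simp)
    qed
    then have "deriv s t = deriv (\<lambda>_. s t) t"
      by (rule deriv_cong_ev) simp
    then show ?thesis
      by simp
  qed
  have "(deriv s has_integral s 1 - s 0) {0..1}"
    by (rule fundamental_theorem_of_calculus)
       (auto simp flip: has_real_derivative_iff_has_vector_derivative
         intro: has_field_derivative_at_within smooth_has_deriv s)
  then have one: "(LINT t|I01. deriv s t) = 1"
    using s(4)[of 0] s(5)[of 1] x by (simp add: continuous_integrable_I01(2)[OF cs] integral_unique)
  have i1: "integrable I01 (\<lambda>t. deriv s t *\<^sub>R v t)"
    by (intro continuous_integrable_I01 continuous_on_scaleR cs v)
  have i2: "integrable I01 (deriv s)"
    by (intro continuous_integrable_I01 cs)
  have "(LINT t|I01. deriv s t *\<^sub>R v t) - v x = (LINT t|I01. deriv s t *\<^sub>R (v t - v x))"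
    using i1 i2 by (simp add: scaleR_diff_right one)
  also have "norm \<dots> \<le> (LINT t|I01. deriv s t * e)"
  proof (rule order_trans[OF integral_norm_bound integral_mono])
    show "integrable I01 (\<lambda>t. norm (deriv s t *\<^sub>R (v t - v x)))"
      using i1 i2 by (intro integrable_norm) (simp add: scaleR_diff_right)
    show "integrable I01 (\<lambda>t. deriv s t * e)"
      using i2 by simp
    show "norm (deriv s t *\<^sub>R (v t - v x)) \<le> deriv s t * e" if "t \<in> space I01" for t
      using s' s(2) v(2)[of t] that by (cases "\<bar>t - x\<bar> \<le> d") (auto intro: mult_left_mono)
  qed
  also have "\<dots> = e"
    using one by simp
  finally show ?thesis .
qed

text \<open>Take \<open>\<eta>\<close> to be a step near \<open>x\<close> minus a step near
  \<open>y\<close>. Integration by parts identifies the integral of \<open>\<eta> g\<close> with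
  minus that of \<open>\<eta>' u'\<close>, which is nearly \<open>u' y - u' x\<close>; on the other
  hand it is at most \<open>norm g\<close>, because \<open>\<eta>\<close> is bounded by 1.\<close>

lemma C1_representative_deriv_diff_le:
  assumes fg: "weak_second_deriv f g" and u: "C1_representative f u u'"
    and x: "x \<in> {0..1}" and y: "y \<in> {0..1}"
  shows "norm (u' x - u' y) \<le> norm g"
proof -
  have du: "\<And>x. x \<in> {0..1} \<Longrightarrow> (u has_vector_derivative u' x) (at x within {0..1})"
    and cu': "continuous_on {0..1} u'" and ae: "AE x in I01. rep_L2 f x = u x"
    using u by (auto simp: C1_representative_def)
  have cu: "continuous_on {0..1} u"
    using du by (meson continuous_on_eq_continuous_within has_vector_derivative_continuous)
  \<comment> \<open>A window inside the open unit interval on which \<open>u'\<close> varies by at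
    most \<open>e\<close>; it exists only around interior points, so the endpoints are reached later
    by continuity.\<close>
  have near: "\<exists>d>0. 0 < x - d \<and> x + d < 1 \<and> (\<forall>t\<in>{0..1}. \<bar>t - x\<bar> \<le> d \<longrightarrow> norm (u' t - u' x) \<le> e)"
    if xe: "x \<in> {0<..<1}" "0 < e" for x e
  proof -
    have "x \<in> {0..1}"
      using that by simp
    then obtain d where d: "d > 0" "\<forall>t\<in>{0..1}. dist t x < d \<longrightarrow> dist (u' t) (u' x) < e"
      using cu' xe(2) unfolding continuous_on_iff by blast
    define d' where "d' = min (d / 2) (min (x / 2) ((1 - x) / 2))"
    have d': "d' \<le> d / 2" "d' \<le> x / 2" "d' \<le> (1 - x) / 2" "0 < d'"
      using d(1) xe(1) unfolding d'_def min_def by (simp_all split: if_split)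
    show ?thesis
    proof (intro exI[of _ d'] conjI ballI impI)
      show "norm (u' t - u' x) \<le> e" if "t \<in> {0..1}" "\<bar>t - x\<bar> \<le> d'" for t
        using d(2)[rule_format, of t] that d'(1) d(1) by (simp add: dist_norm)
    qed (use d' that in auto)
  qed
  have open_int: "norm (u' x - u' y) \<le> norm g" if xy: "x \<in> {0<..<1}" "y \<in> {0<..<1}" for x y
  proof (rule field_le_epsilon)
    fix e :: real assume "0 < e"
    then have e2: "0 < e / 2"
      by simp
    obtain d where d: "d > 0" "0 < x - d" "x + d < 1"
        "\<And>t. t \<in> {0..1} \<Longrightarrow> \<bar>t - x\<bar> \<le> d \<Longrightarrow> norm (u' t - u' x) \<le> e / 2"
      using near[OF xy(1) e2] by blast
    obtain d' where d': "d' > 0" "0 < y - d'" "y + d' < 1"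
        "\<And>t. t \<in> {0..1} \<Longrightarrow> \<bar>t - y\<bar> \<le> d' \<Longrightarrow> norm (u' t - u' y) \<le> e / 2"
      using near[OF xy(2) e2] by blast
    have lt: "x - d < x + d" "y - d' < y + d'"
      using d(1) d'(1) by auto
    obtain s s' where steps: "smooth_step (x - d) (x + d) s" "smooth_step (y - d') (y + d') s'"
      using smooth_step_exists[OF lt(1)] smooth_step_exists[OF lt(2)] by blast
    note s = smooth_stepD[OF steps(1)] and s' = smooth_stepD[OF steps(2)]
    define \<eta> where "\<eta> = (\<lambda>t. s t - s' t)"
    have eq: "s t = s' t" if "t \<le> min (x - d) (y - d') \<or> max (x + d) (y + d') \<le> t" for t
      using that s(4,5)[of t] s'(4,5)[of t] by auto
    have \<eta>: "test_function \<eta>"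
      unfolding \<eta>_def
      by (rule test_function_step_diff[where a = "min (x - d) (y - d')" and b = "max (x + d) (y + d')"])
         (use d(2,3) d'(2,3) s(1) s'(1) eq in simp_all)
    have \<eta>1: "\<bar>\<eta> t\<bar> \<le> 1" for t
      using s(3)[of t] s'(3)[of t] unfolding \<eta>_def by linarith
    have d\<eta>: "deriv \<eta> t = deriv s t - deriv s' t" for t
      unfolding \<eta>_def by (intro DERIV_imp_deriv DERIV_diff smooth_has_deriv s s')
    have ints: "integrable I01 (\<lambda>t. deriv s t *\<^sub>R u' t)" "integrable I01 (\<lambda>t. deriv s' t *\<^sub>R u' t)"
      by (intro continuous_integrable_I01 continuous_on_scaleR smooth_continuous smooth_deriv s s' cu')+
    have "(LINT t|I01. deriv s t *\<^sub>R u' t) - (LINT t|I01. deriv s' t *\<^sub>R u' t)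
        = (LINT t|I01. deriv \<eta> t *\<^sub>R u' t)"
      using ints by (simp add: d\<eta> scaleR_diff_left)
    also have "\<dots> = - (LINT t|I01. (deriv ^^ 2) \<eta> t *\<^sub>R u t)"
      using integral_by_parts_test_function[OF \<eta> du cu'] by simp
    also have "(LINT t|I01. (deriv ^^ 2) \<eta> t *\<^sub>R u t) = (LINT t|I01. (deriv ^^ 2) \<eta> t *\<^sub>R rep_L2 f t)"
    proof (rule integral_cong_AE)
      have c: "continuous_on {0..1} ((deriv ^^ 2) \<eta>)"
        by (intro smooth_continuous smooth_deriv2 test_function_smooth \<eta>)
      show "(\<lambda>t. (deriv ^^ 2) \<eta> t *\<^sub>R u t) \<in> borel_measurable I01"
        by (intro borel_measurable_integrable continuous_integrable_I01 continuous_on_scaleR c cu)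
      show "(\<lambda>t. (deriv ^^ 2) \<eta> t *\<^sub>R rep_L2 f t) \<in> borel_measurable I01"
        by (intro borel_measurable_integrable continuous_times_integrable_I01 c
            square_integrable_imp_integrable square_integrable_rep)
      show "AE t in I01. (deriv ^^ 2) \<eta> t *\<^sub>R u t = (deriv ^^ 2) \<eta> t *\<^sub>R rep_L2 f t"
        using ae by eventually_elim simp
    qed
    also have "\<dots> = (LINT t|I01. \<eta> t *\<^sub>R rep_L2 g t)"
      by (rule weak_second_derivD[OF fg \<eta>])
    finally have "norm ((LINT t|I01. deriv s t *\<^sub>R u' t) - (LINT t|I01. deriv s' t *\<^sub>R u' t)) \<le> norm g"
      using norm_integral_le_norm_L2[OF \<eta>1] by simp
    moreover have "norm ((LINT t|I01. deriv s t *\<^sub>R u' t) - u' x) \<le> e / 2"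
      by (rule integral_deriv_step_approx[OF steps(1) cu' d(4,2,3)])
    moreover have "norm ((LINT t|I01. deriv s' t *\<^sub>R u' t) - u' y) \<le> e / 2"
      by (rule integral_deriv_step_approx[OF steps(2) cu' d'(4,2,3)])
    ultimately show "norm (u' x - u' y) \<le> norm g + e"
      by norm
  qed
  have cl: "closure {0<..<1} = {0..1::real}"
    by simp
  \<comment> \<open>The estimate extends to the closed interval by continuity of \<open>u'\<close>,
    one variable at a time.\<close>
  have half: "norm (u' x - u' y) \<le> norm g" if "y \<in> {0<..<1}" "x \<in> {0..1}" for x y
    by (rule continuous_on_closure_norm_le[of "{0<..<1}" "\<lambda>x. u' x - u' y"])
       (use open_int that cl in \<open>auto intro!: continuous_intros cu'\<close>)
  show ?thesis
    by (rule continuous_on_closure_norm_le[of "{0<..<1}" "\<lambda>y. u' x - u' y"])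
       (use half x y cl in \<open>auto intro!: continuous_intros cu'\<close>)
qed

lemma norm_complex_2_le: "norm (v :: complex^2) \<le> norm (v $ 1) + norm (v $ 2)"
  using L2_set_le_sum[of UNIV "\<lambda>i. norm (v $ i)"] by (simp add: norm_vec_def sum_2)

text \<open>A bound on the oscillation of \<open>u'\<close> becomes a bound on \<open>u'\<close>
  once each component is anchored: the second by its zero at 0, the first by its vanishing mean,
  since \<open>u 1 - u 0\<close> has first component 0. The Lipschitz bound follows, and with the
  norm of \<open>f\<close> the uniform bound.\<close>

lemma Dom_D_representative_bounds:
  assumes "f \<in> Dom_D" "weak_second_deriv f g"
  shows "\<exists>u. (AE x in I01. rep_L2 f x = u x) \<and>
    (\<forall>x\<in>{0..1}. norm (u x) \<le> norm f + 2 * norm g) \<and>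
    (\<forall>x\<in>{0..1}. \<forall>y\<in>{0..1}. norm (u x - u y) \<le> 2 * norm g * \<bar>x - y\<bar>)"
proof -
  obtain u u' where u: "C1_representative f u u'"
    and bc: "u 0 $ 1 = 0" "u 1 $ 1 = 0" "u' 0 $ 2 = 0"
    using assms(1) unfolding Dom_D_def by blast
  have du: "\<And>x. x \<in> {0..1} \<Longrightarrow> (u has_vector_derivative u' x) (at x within {0..1})"
    and ae: "AE x in I01. rep_L2 f x = u x"
    using u by (auto simp: C1_representative_def)
  note osc = C1_representative_deriv_diff_le[OF assms(2) u]
  have bound': "norm (u' x) \<le> 2 * norm g" if x: "x \<in> {0..1}" for x
  proof -
    \<comment> \<open>Over the whole interval \<open>u\<close> deviates from its linearization with
      slope \<open>u' x\<close> by at most the oscillation of \<open>u'\<close>.\<close>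
    have "norm (u 1 - u 0 - (1 - 0) *\<^sub>R u' x) \<le> norm (1 - 0 :: real) * norm g"
      by (rule vector_differentiable_bound_linearization[OF du])
         (use x osc in \<open>auto simp: closed_segment_eq_real_ivl\<close>)
    then have "norm (u' x $ 1) \<le> norm g"
      using Finite_Cartesian_Product.norm_nth_le[of "u 1 - u 0 - u' x" 1] bc by simp
    moreover have "norm (u' x $ 2) \<le> norm g"
      using Finite_Cartesian_Product.norm_nth_le[of "u' x - u' 0" 2] osc[OF x, of 0] bc by simp
    ultimately show ?thesis
      using norm_complex_2_le[of "u' x"] by linarith
  qed
  have lip: "norm (u x - u y) \<le> 2 * norm g * \<bar>x - y\<bar>" if "x \<in> {0..1}" "y \<in> {0..1}" for x y
  proof -
    have "norm (u x - u y) \<le> 2 * norm g * norm (x - y)"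
    proof (rule differentiable_bound[of "{0..1}" u "\<lambda>x h. h *\<^sub>R u' x"])
      show "(u has_derivative (\<lambda>h. h *\<^sub>R u' x)) (at x within {0..1})" if "x \<in> {0..1}" for x
        using du[OF that] by (simp add: has_vector_derivative_def)
      show "onorm (\<lambda>h. h *\<^sub>R u' x) \<le> 2 * norm g" if "x \<in> {0..1}" for x
        by (rule onorm_le) (use mult_left_mono[OF bound'[OF that] abs_ge_zero] in \<open>simp add: mult.commute\<close>)
    qed (use that in auto)
    then show ?thesis
      by simp
  qed
  have "norm (u x) \<le> norm f + 2 * norm g" if x: "x \<in> {0..1}" for x
  proof -
    have "AE t in I01. t \<in> space I01"
      by (rule AE_space)
    \<comment> \<open>By the Lipschitz bound the value at \<open>x\<close> controls all other values
      from below, so this constant is also a lower bound for \<open>norm f\<close>.\<close>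
    with ae have "AE t in I01. norm (u x) - 2 * norm g \<le> norm (rep_L2 f t)"
    proof eventually_elim
      case (elim t)
      then have t: "t \<in> {0..1}"
        by simp
      have "norm (u x - u t) \<le> 2 * norm g * \<bar>x - t\<bar>"
        by (rule lip[OF x t])
      also have "\<dots> \<le> 2 * norm g * 1"
        using x t by (intro mult_left_mono) auto
      finally show ?case
        using elim norm_triangle_ineq2[of "u x" "u t"] by simp
    qed
    then show ?thesis
      using norm_L2_ge_const by fastforce
  qed
  then show ?thesis
    using ae lip by (intro exI[of _ u]) simp
qed

section \<open>Compactness of the resolvent\<close>

lemma C1_representative_add:
  assumes "C1_representative f u u'" "C1_representative g v v'"
  shows "C1_representative (f + g) (\<lambda>x. u x + v x) (\<lambda>x. u' x + v' x)"
proof -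
  have "AE x in I01. rep_L2 f x = u x" "AE x in I01. rep_L2 g x = v x"
    using assms by (auto simp: C1_representative_def)
  then have "AE x in I01. rep_L2 (f + g) x = u x + v x"
    using rep_L2_add[of f g] by eventually_elim simp
  then show ?thesis
    using assms by (auto simp: C1_representative_def
        intro!: has_vector_derivative_add continuous_on_add)
qed

lemma C1_representative_scaleC:
  assumes "C1_representative f u u'"
  shows "C1_representative (c *\<^sub>C f) (\<lambda>x. c *s u x) (\<lambda>x. c *s u' x)"
proof -
  note bl = bounded_linear_vector_scalar_mult_complex[of c]
  have "AE x in I01. rep_L2 f x = u x"
    using assms by (auto simp: C1_representative_def)
  then have "AE x in I01. rep_L2 (c *\<^sub>C f) x = c *s u x"
    using rep_L2_scaleC[of c f] by eventually_elim simp
  then show ?thesis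
    using assms by (auto simp: C1_representative_def
        intro!: bounded_linear.has_vector_derivative[OF bl] bounded_linear.continuous_on[OF bl])
qed

lemma Dom_D_weak_second_deriv: "f \<in> Dom_D \<Longrightarrow> weak_second_deriv f (second_deriv f)"
  unfolding Dom_D_def W22_def using second_deriv_eq by auto

lemma Dom_D_add:
  assumes "f \<in> Dom_D" "g \<in> Dom_D"
  shows "f + g \<in> Dom_D"
proof -
  obtain u u' where u: "C1_representative f u u'" "u 0 $ 1 = 0" "u 1 $ 1 = 0" "u' 0 $ 2 = 0" "u' 1 $ 2 = 0"
    using assms(1) unfolding Dom_D_def by blast
  obtain v v' where v: "C1_representative g v v'" "v 0 $ 1 = 0" "v 1 $ 1 = 0" "v' 0 $ 2 = 0" "v' 1 $ 2 = 0"
    using assms(2) unfolding Dom_D_def by blast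
  have "f + g \<in> W22"
    using weak_second_deriv_add[OF assms[THEN Dom_D_weak_second_deriv]] by (auto simp: W22_def)
  moreover have "\<exists>w w'. C1_representative (f + g) w w' \<and>
      w 0 $ 1 = 0 \<and> w 1 $ 1 = 0 \<and> w' 0 $ 2 = 0 \<and> w' 1 $ 2 = 0"
    by (rule exI[of _ "\<lambda>x. u x + v x"], rule exI[of _ "\<lambda>x. u' x + v' x"])
       (simp add: C1_representative_add u v)
  ultimately show ?thesis
    by (simp add: Dom_D_def)
qed

lemma Dom_D_scaleC:
  assumes "f \<in> Dom_D"
  shows "c *\<^sub>C f \<in> Dom_D"
proof -
  obtain u u' where u: "C1_representative f u u'" "u 0 $ 1 = 0" "u 1 $ 1 = 0" "u' 0 $ 2 = 0" "u' 1 $ 2 = 0"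
    using assms unfolding Dom_D_def by blast
  have "c *\<^sub>C f \<in> W22"
    using weak_second_deriv_scaleC[OF Dom_D_weak_second_deriv[OF assms]] by (auto simp: W22_def)
  moreover have "\<exists>w w'. C1_representative (c *\<^sub>C f) w w' \<and>
      w 0 $ 1 = 0 \<and> w 1 $ 1 = 0 \<and> w' 0 $ 2 = 0 \<and> w' 1 $ 2 = 0"
    by (rule exI[of _ "\<lambda>x. c *s u x"], rule exI[of _ "\<lambda>x. c *s u' x"])
       (simp add: C1_representative_scaleC u)
  ultimately show ?thesis
    by (simp add: Dom_D_def)
qed

lemma op_AD_add:
  assumes "f \<in> Dom_D" "g \<in> Dom_D"
  shows "op_AD A (f + g) = op_AD A f + op_AD A g"
proof -
  have "second_deriv (f + g) = second_deriv f + second_deriv g"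
    by (intro second_deriv_eq weak_second_deriv_add Dom_D_weak_second_deriv assms)
  then have "op_D (f + g) = op_D f + op_D g"
    by (simp add: op_D_def)
  then show ?thesis
    by (simp add: op_AD_def matrix_L2_add)
qed

lemma op_AD_scaleC:
  assumes "f \<in> Dom_D"
  shows "op_AD A (c *\<^sub>C f) = c *\<^sub>C op_AD A f"
proof -
  have "second_deriv (c *\<^sub>C f) = c *\<^sub>C second_deriv f"
    by (intro second_deriv_eq weak_second_deriv_scaleC Dom_D_weak_second_deriv assms)
  then have "op_D (c *\<^sub>C f) = c *\<^sub>C op_D f"
    by (simp add: op_D_def scaleC_L2_uminus)
  then show ?thesis
    by (simp add: op_AD_def matrix_L2_scaleC)
qed

section \<open>From equi-Lipschitz representatives to relatively compact sets\<close>

lemma square_integrable_continuous: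
  assumes "continuous_on {0..1} u"
  shows "square_integrable u"
  unfolding square_integrable_def
  by (intro conjI borel_measurable_integrable continuous_integrable_I01 continuous_intros assms)

text \<open>Arzela-Ascoli yields a subsequence of the representatives converging uniformly to a
  continuous limit; on an interval of measure 1 uniform convergence implies convergence in
  \<open>L2\<close>.\<close>

lemma equi_Lipschitz_convergent_subsequence:
  fixes f :: "nat \<Rightarrow> L2" and L :: real
  assumes "\<And>n. \<exists>u. (AE x in I01. rep_L2 (f n) x = u x) \<and> (\<forall>x\<in>{0..1}. norm (u x) \<le> L) \<and>
      (\<forall>x\<in>{0..1}. \<forall>y\<in>{0..1}. norm (u x - u y) \<le> L * \<bar>x - y\<bar>)"
  shows "\<exists>l r. strict_mono r \<and> (f \<circ> r) \<longlonglongrightarrow> l"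
proof -
  obtain u where "\<forall>n. (AE x in I01. rep_L2 (f n) x = u n x) \<and> (\<forall>x\<in>{0..1}. norm (u n x) \<le> L) \<and>
      (\<forall>x\<in>{0..1}. \<forall>y\<in>{0..1}. norm (u n x - u n y) \<le> L * \<bar>x - y\<bar>)"
    using choice[OF allI[OF assms]] by (rule exE)
  then have u: "\<And>n. AE x in I01. rep_L2 (f n) x = u n x"
      "\<And>n x. x \<in> {0..1} \<Longrightarrow> norm (u n x) \<le> L"
      "\<And>n x y. x \<in> {0..1} \<Longrightarrow> y \<in> {0..1} \<Longrightarrow> norm (u n x - u n y) \<le> L * \<bar>x - y\<bar>"
    by simp_all
  have equi: "\<exists>d>0. \<forall>n y. y \<in> {0..1} \<and> norm (x - y) < d \<longrightarrow> norm (u n x - u n y) < e"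
    if x: "x \<in> {0..1}" and e: "0 < e" for x e
  \<comment> \<open>The added 1 keeps the denominator positive when \<open>L\<close> is 0.\<close>
  proof (intro exI[of _ "e / (\<bar>L\<bar> + 1)"] conjI allI impI)
    show "0 < e / (\<bar>L\<bar> + 1)"
      using e by simp
    show "norm (u n x - u n y) < e" if y: "y \<in> {0..1} \<and> norm (x - y) < e / (\<bar>L\<bar> + 1)" for n y
    proof -
      have "norm (u n x - u n y) \<le> L * \<bar>x - y\<bar>"
        using u(3) x y by blast
      also have "\<dots> \<le> (\<bar>L\<bar> + 1) * \<bar>x - y\<bar>"
        by (intro mult_right_mono) auto
      also have "\<dots> < e"
        using y by (simp add: pos_less_divide_eq mult.commute)
      finally show ?thesis .
    qed
  qed
  obtain g r where g: "continuous_on {0..1} g" and r: "strict_mono (r :: nat \<Rightarrow> nat)"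
    and lim: "\<And>e. 0 < e \<Longrightarrow> \<exists>N. \<forall>n x. n \<ge> N \<and> x \<in> {0..1} \<longrightarrow> norm (u (r n) x - g x) < e"
    by (rule Arzela_Ascoli[of "{0..1::real}" u L]) (use u(2) equi in auto)
  have "(f \<circ> r) \<longlonglongrightarrow> abs_L2 g"
  proof (rule metric_LIMSEQ_I)
    fix e :: real assume "0 < e"
    then obtain N where N: "\<And>n x. n \<ge> N \<Longrightarrow> x \<in> {0..1} \<Longrightarrow> norm (u (r n) x - g x) < e / 2"
      using lim[of "e / 2"] by auto
    have "dist ((f \<circ> r) n) (abs_L2 g) < e" if n: "n \<ge> N" for n
    proof -
      have "AE x in I01. x \<in> space I01"
        by (rule AE_space)
      then have "AE x in I01. norm (rep_L2 (f (r n) - abs_L2 g) x) \<le> e / 2"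
        using u(1)[of "r n"] rep_abs_L2[OF square_integrable_continuous[OF g]]
          rep_L2_diff[of "f (r n)" "abs_L2 g"]
      proof eventually_elim
        case (elim x)
        then show ?case
          using N[OF n, of x] by simp
      qed
      then have "norm (f (r n) - abs_L2 g) \<le> e / 2"
        by (rule norm_L2_le_const) (use \<open>0 < e\<close> in simp)
      then show ?thesis
        using \<open>0 < e\<close> by (simp add: dist_norm)
    qed
    then show "\<exists>N. \<forall>n\<ge>N. dist ((f \<circ> r) n) (abs_L2 g) < e"
      by blast
  qed
  then show ?thesis
    using r by blast
qed

text \<open>A sequence in the closure is shadowed by one in \<open>S\<close> with errors below
  \<open>1 / (n + 1)\<close>; a convergent subsequence of the shadow makes the original converge to
  the same limit, which lies in the closure.\<close>

lemma compact_closure_if_convergent_subsequences: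
  fixes S :: "'a::metric_space set"
  assumes "\<And>f :: nat \<Rightarrow> 'a. (\<And>n. f n \<in> S) \<Longrightarrow> \<exists>l r. strict_mono r \<and> (f \<circ> r) \<longlonglongrightarrow> l"
  shows "compact (closure S)"
  unfolding compact_def
proof (intro allI impI)
  fix g :: "nat \<Rightarrow> 'a" assume g: "\<forall>n. g n \<in> closure S"
  have "\<exists>y\<in>S. dist y (g n) < inverse (real (Suc n))" for n
    using g by (simp add: closure_approachable)
  then obtain f where f: "\<And>n. f n \<in> S" "\<And>n. dist (f n) (g n) < inverse (real (Suc n))"
    by metis
  obtain l r where r: "strict_mono r" and l: "(f \<circ> r) \<longlonglongrightarrow> l"
    using assms[of f, OF f(1)] by blast
  have "(\<lambda>n. dist (f n) (g n)) \<longlonglongrightarrow> 0"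
    by (rule tendsto_sandwich[OF _ _ tendsto_const LIMSEQ_inverse_real_of_nat])
       (use f(2) in \<open>auto intro!: always_eventually less_imp_le\<close>)
  then have "(\<lambda>n. dist ((f \<circ> r) n) ((g \<circ> r) n)) \<longlonglongrightarrow> 0"
    using LIMSEQ_subseq_LIMSEQ[OF _ r] by (fastforce simp: o_def)
  with l have "(\<lambda>n. dist ((f \<circ> r) n) ((g \<circ> r) n) + dist ((f \<circ> r) n) l) \<longlonglongrightarrow> 0"
    unfolding tendsto_dist_iff[of "f \<circ> r"] by (rule tendsto_add_zero[rotated])
  then have "(\<lambda>n. dist ((g \<circ> r) n) l) \<longlonglongrightarrow> 0"
    by (rule tendsto_sandwich[OF _ _ tendsto_const, rotated -1])
       (auto intro!: always_eventually dist_triangle3)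
  then have "(g \<circ> r) \<longlonglongrightarrow> l"
    by (rule tendsto_dist_iff[THEN iffD2])
  moreover have "l \<in> closure S"
    unfolding closure_sequential using f(1) l by (intro exI[of _ "f \<circ> r"]) auto
  ultimately show "\<exists>l\<in>closure S. \<exists>r. strict_mono r \<and> (g \<circ> r) \<longlonglongrightarrow> l"
    using r by blast
qed

theorem theorem7:
  fixes A :: "complex^2^2" and z :: complex
  assumes "invertible A"
    and "z \<notin> spectrum Dom_D (op_AD A)"
  shows "compact_operator (resolvent Dom_D (op_AD A) z)"
proof -
  define T where "T f = op_AD A f - z *\<^sub>C f" for f
  define R where "R = resolvent Dom_D (op_AD A) z"
  have R_inv: "R = inv_into Dom_D T"
    by (simp add: R_def resolvent_def T_def[abs_def])
  have bij: "bij_betw T Dom_D UNIV"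
    using assms(2) by (simp add: spectrum_def T_def[abs_def])
  obtain K where K: "\<And>g. norm (R g) \<le> K * norm g"
    using assms(2) by (auto simp: spectrum_def R_def T_def[abs_def])
  have R_Dom: "R g \<in> Dom_D" and T_R: "T (R g) = g" for g
    using bij unfolding R_inv bij_betw_def by (auto intro: inv_into_into f_inv_into_f)
  have R_T: "R (T f) = f" if "f \<in> Dom_D" for f
    using bij that unfolding R_inv bij_betw_def by simp
  have T_add: "T (f + g) = T f + T g" if "f \<in> Dom_D" "g \<in> Dom_D" for f g
    using that by (simp add: T_def op_AD_add scaleC_L2_add)
  have T_scaleC: "T (c *\<^sub>C f) = c *\<^sub>C T f" if "f \<in> Dom_D" for c f
    using that by (simp add: T_def op_AD_scaleC scaleC_L2_diff scaleC_L2_commute[of z c])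
  \<comment> \<open>The inverse of a linear bijection defined on a subspace is linear:
    \<open>R_T\<close> is applied to the sum or multiple of values of \<open>R\<close>.\<close>
  have linear: "complex_linear R"
    unfolding complex_linear_def
  proof (intro conjI allI)
    show "R (f + g) = R f + R g" for f g
      using R_T[OF Dom_D_add[OF R_Dom R_Dom], of f g] by (simp add: T_add R_Dom T_R)
    show "R (c *\<^sub>C f) = c *\<^sub>C R f" for c f
      using R_T[OF Dom_D_scaleC[OF R_Dom], of c f] by (simp add: T_scaleC R_Dom T_R)
  qed
  obtain B where B: "B ** A = mat 1"
    using assms(1) unfolding invertible_def by blast
  obtain b where b: "0 \<le> b" "\<And>f. norm (matrix_L2 B f) \<le> b * norm f"
    using matrix_L2_bounded by blast
  obtain c where c: "0 \<le> c" "\<And>f. norm (z *\<^sub>C f) \<le> c * norm f"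
    using scaleC_L2_bounded by blast
  have deriv_bound: "norm (second_deriv (R g)) \<le> b * (norm g + c * (K * norm g))" for g
  proof -
    \<comment> \<open>The resolvent equation; applying the left inverse \<open>B\<close> of
      \<open>A\<close> solves it for the second derivative.\<close>
    have "matrix_L2 A (- second_deriv (R g)) = g + z *\<^sub>C R g"
      using T_R[of g] by (simp add: T_def op_AD_def op_D_def algebra_simps)
    then have "matrix_L2 B (g + z *\<^sub>C R g) = - second_deriv (R g)"
      by (metis B matrix_L2_mult matrix_L2_one)
    then have "norm (second_deriv (R g)) \<le> b * norm (g + z *\<^sub>C R g)"
      using b(2)[of "g + z *\<^sub>C R g"] by simp
    also have "\<dots> \<le> b * (norm g + c * norm (R g))"
      using b(1) c(2)[of "R g"] norm_triangle_ineq[of g "z *\<^sub>C R g"] by (intro mult_left_mono) auto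
    also have "\<dots> \<le> b * (norm g + c * (K * norm g))"
      using b(1) c(1) K by (intro mult_left_mono add_left_mono) auto
    finally show ?thesis .
  qed
  have "compact (closure (R ` S))" if S: "bounded S" for S
  proof (rule compact_closure_if_convergent_subsequences)
    obtain M where M: "0 < M" "\<forall>g\<in>S. norm g \<le> M"
      using S unfolding bounded_pos by blast
    \<comment> \<open>The bound for \<open>norm f + 2 * norm f''\<close> over the image of
      \<open>S\<close>; it also dominates the Lipschitz constant \<open>2 * norm f''\<close>. The
      absolute value appears because the sign of \<open>K\<close> is not prescribed by
      \<open>spectrum\<close>.\<close>
    define L where "L = \<bar>K\<bar> * M + 2 * (b * (M + c * (\<bar>K\<bar> * M)))"
    fix f :: "nat \<Rightarrow> L2" assume f: "\<And>n. f n \<in> R ` S"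
    show "\<exists>l r. strict_mono r \<and> (f \<circ> r) \<longlonglongrightarrow> l"
    proof (rule equi_Lipschitz_convergent_subsequence)
      fix n
      obtain g where g: "g \<in> S" "f n = R g"
        using f by blast
      have Kg: "K * norm g \<le> \<bar>K\<bar> * M"
        by (rule mult_mono) (use M(2) g(1) in auto)
      have fn: "norm (f n) \<le> \<bar>K\<bar> * M"
        using K[of g] Kg g(2) by simp
      have "b * (norm g + c * (K * norm g)) \<le> b * (M + c * (\<bar>K\<bar> * M))"
        by (intro mult_left_mono add_mono M(2)[rule_format] g Kg b c)
      then have sd: "norm (second_deriv (f n)) \<le> b * (M + c * (\<bar>K\<bar> * M))"
        using deriv_bound[of g] g(2) by simp
      have nonneg: "0 \<le> \<bar>K\<bar> * M"
        using M(1) by simp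
      have fD: "f n \<in> Dom_D"
        using g(2) R_Dom by simp
      obtain u where u: "AE x in I01. rep_L2 (f n) x = u x"
        "\<forall>x\<in>{0..1}. norm (u x) \<le> norm (f n) + 2 * norm (second_deriv (f n))"
        "\<forall>x\<in>{0..1}. \<forall>y\<in>{0..1}. norm (u x - u y) \<le> 2 * norm (second_deriv (f n)) * \<bar>x - y\<bar>"
        using Dom_D_representative_bounds[OF fD Dom_D_weak_second_deriv[OF fD]] by blast
      show "\<exists>u. (AE x in I01. rep_L2 (f n) x = u x) \<and> (\<forall>x\<in>{0..1}. norm (u x) \<le> L) \<and>
          (\<forall>x\<in>{0..1}. \<forall>y\<in>{0..1}. norm (u x - u y) \<le> L * \<bar>x - y\<bar>)"
      proof (intro exI[of _ u] conjI ballI)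
        show "norm (u x) \<le> L" if "x \<in> {0..1}" for x
          using u(2)[rule_format, OF that] fn sd by (simp add: L_def)
        show "norm (u x - u y) \<le> L * \<bar>x - y\<bar>" if "x \<in> {0..1}" "y \<in> {0..1}" for x y
        proof -
          have "2 * norm (second_deriv (f n)) * \<bar>x - y\<bar> \<le> L * \<bar>x - y\<bar>"
            using sd nonneg by (intro mult_right_mono) (simp_all add: L_def)
          then show ?thesis
            using u(3)[rule_format, OF that] by linarith
        qed
      qed (fact u(1))
    qed
  qed
  then show ?thesis
    using linear by (simp add: compact_operator_def R_def)
qed

end
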